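(* Let $\mathfrak{u}$ be a compact Lie algebra with $\operatorname{rank}(\mathfrak{u})=2d+2p$, where $d$ is the number of roots in the stem $\Gamma$ of $\Delta^+$ and $p$ is a nonnegative even integer. Let $I$ be an admissible $\mathfrak{b}^+$-complex structure on $\mathfrak{u}$. Let $S_1,\dots,S_p$ be a basis of $\mathfrak{j}^+$ and $T_k=\tau(S_k)$, $k=1,\dots,p$. Then every hypercomplex structure on $\mathfrak{u}$ of the form $(I,J_0)$ is equivalent to a hypercomplex structure $(I,J)$ for which there exists a complex $p\times p$ matrix $\mathbf{b}=(b_{kq})$ with $\overline{\mathbf{b}}\,\mathbf{b}=-1$ such that for all $\gamma\in\Gamma$, $\alpha\in\Phi_\gamma^+$ and $q=1,\dots,p$, $$JE_\gamma=Q_\gamma,\qquad JE_\alpha=i\,N_{\gamma,-\alpha}E_{s_\gamma(\alpha)},\qquad J(S_q)=\sum_{k=1}^p b_{kq}T_k .$$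
   Context: $\mathfrak{u}$ is a compact Lie algebra, $\mathfrak{g}=\mathfrak{u}^{\mathbb C}$, $\tau$ the conjugation of $\mathfrak{g}$ with respect to $\mathfrak{u}$, $\mathfrak{h}$ a $\tau$-stable Cartan subalgebra of $\mathfrak{g}$ (rank means $\dim_{\mathbb C}\mathfrak h$), $\Delta\subset\mathfrak{h}^*$ the roots, $\Delta^+$ a system of positive roots, $\mathfrak{g}(\alpha)$ the root spaces, $\mathfrak{n}^+=\bigoplus_{\alpha\in\Delta^+}\mathfrak{g}(\alpha)$, $\mathfrak{b}^+=\mathfrak{h}\oplus\mathfrak{n}^+$, $H_\alpha\in\mathfrak{h}$ the coroot of $\alpha$ ($\alpha(H_\alpha)=2$), $s_\alpha$ the reflection along $\alpha$. Fix a Weyl–Chevalley basis: $E_\alpha\in\mathfrak{g}(\alpha)$, $[E_\alpha,E_{-\alpha}]=H_\alpha$, $[E_\alpha,E_\beta]=N_{\alpha,\beta}E_{\alpha+\beta}$ for $\alpha,\beta,\alpha+\beta\in\Delta$, with integers $N_{\alpha,\beta}=-N_{-\alpha,-\beta}$, $|N_{\alpha,\beta}|=1-p_0$ where $\beta+n\alpha$, $p_0\le n\le q_0$, is the $\alpha$-series of $\beta$; and $\tau(E_\alpha)=-E_{-\alpha}$, $\tau(H_\alpha)=-H_\alpha$. Stem: $\Phi_\gamma^+=\{\alpha\in\Delta^+\mid\gamma-\alpha\in\Delta^+\}$; $\Gamma$ is the unique subset of $\Delta^+$ with $\Delta^+=\Gamma\cup\bigcup_{\gamma\in\Gamma}\Phi_\gamma^+$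 (disjoint union). A complex structure on $\mathfrak{u}$ is a linear $I:\mathfrak{u}\to\mathfrak{u}$ with $I^2=-1$, extended $\mathbb C$-linearly to $\mathfrak{g}$; $\mathfrak{m}_I^{\pm}=\{X\in\mathfrak{g}\mid IX=\pm iX\}$. $I$ is integrable if $\mathfrak{m}_I^+$ is a subalgebra. $I$ is a $\mathfrak{b}^+$-complex structure if it is integrable and the normalizer of $\mathfrak{m}_I^+$ in $\mathfrak{g}$ is $\mathfrak{b}^+$; then $\mathfrak{m}_I^+=\mathfrak{h}^+\oplus\mathfrak{n}^+$ with $\mathfrak{h}^+=\mathfrak{h}\cap\mathfrak{m}^+_I$. $J$ matches $I$ if $J$ is an integrable complex structure on $\mathfrak{u}$ with $IJ=-JI$; $I$ is admissible if some $J$ matches $I$. A hypercomplex structure on $\mathfrak{u}$ is a pair $(I,J)$ of integrable complex structures with $IJ=-JI$; $(I,J)$ and $(I',J')$ are equivalent if there is an automorphism $\xi$ of $\mathfrak{u}$ with $\xi I=I'\xi$ and $\xi J=J'\xi$. For $\gamma\in\Gamma$: $W_\gamma=\frac i2H_\gamma$, $Z_\gamma=IW_\gamma$, $Q_\gamma=W_\gamma+iZ_\gamma$. Further $\mathfrak{o}=\{H\in\mathfrak{h}\mid\gamma(H)=0\ \forall\gamma\in\Gamma\}$ and $\mathfrak{j}^+=\mathfrak{o}\cap\mathfrak{h}^+$ (for admissible $I$ it has complex dimension $p$). *)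

theory Defs
  imports
    "HOL-Analysis.Linear_Algebra"
    "HOL-Library.Function_Algebras"
    "Jordan_Normal_Form.Matrix"
begin

locale real_lie_algebra =
  fixes br :: "'u::real_vector \<Rightarrow> 'u \<Rightarrow> 'u"
  assumes bilinear_br: "bilinear br"
    and br_self: "br x x = 0"
    and jacobi: "br x (br y z) + br y (br z x) + br z (br x y) = 0"

text \<open>Compactness is expressed by an invariant inner product; a nontrivial centre is allowed.\<close>

locale compact_lie_algebra = real_lie_algebra br
  for br :: "'u::real_vector \<Rightarrow> 'u \<Rightarrow> 'u" +
  assumes finite_dimensional: "\<exists>B :: 'u set. finite B \<and> span B = UNIV"
    and invariant_inner_product:
      "\<exists>ip :: 'u \<Rightarrow> 'u \<Rightarrow> real. bilinear ip \<and> (\<forall>x y. ip x y = ip y x) \<and>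
         (\<forall>x. x \<noteq> 0 \<longrightarrow> ip x x > 0) \<and> (\<forall>x y z. ip (br x y) z = ip x (br y z))"

definition lie_automorphism :: "('u::real_vector \<Rightarrow> 'u \<Rightarrow> 'u) \<Rightarrow> ('u \<Rightarrow> 'u) \<Rightarrow> bool" where
  "lie_automorphism br \<xi> \<longleftrightarrow> linear \<xi> \<and> bij \<xi> \<and> (\<forall>x y. \<xi> (br x y) = br (\<xi> x) (\<xi> y))"

text \<open>The pair \<open>(x, y)\<close> stands for \<open>x + \<i>y\<close>.\<close>

type_synonym 'u cx = "'u \<times> 'u"

definition cx_scale :: "complex \<Rightarrow> 'u::real_vector cx \<Rightarrow> 'u cx" (infixr "*\<^sub>C" 75) where
  "z *\<^sub>C X = (Re z *\<^sub>R fst X - Im z *\<^sub>R snd X, Re z *\<^sub>R snd X + Im z *\<^sub>R fst X)"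

global_interpretation cx: vector_space "cx_scale :: complex \<Rightarrow> 'u::real_vector cx \<Rightarrow> 'u cx"
  by unfold_locales (auto simp: cx_scale_def algebra_simps)

definition cx_bracket :: "('u::real_vector \<Rightarrow> 'u \<Rightarrow> 'u) \<Rightarrow> 'u cx \<Rightarrow> 'u cx \<Rightarrow> 'u cx" where
  "cx_bracket br X Y =
     (br (fst X) (fst Y) - br (snd X) (snd Y), br (fst X) (snd Y) + br (snd X) (fst Y))"

definition cx_conj :: "'u::real_vector cx \<Rightarrow> 'u cx" where
  "cx_conj X = (fst X, - snd X)"

definition cx_extend :: "('u::real_vector \<Rightarrow> 'u) \<Rightarrow> 'u cx \<Rightarrow> 'u cx" where
  "cx_extend f X = (f (fst X), f (snd X))"

definition cx_subalgebra :: "('u::real_vector \<Rightarrow> 'u \<Rightarrow> 'u) \<Rightarrow> 'u cx set \<Rightarrow> bool" where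
  "cx_subalgebra br A \<longleftrightarrow> cx.subspace A \<and> (\<forall>X\<in>A. \<forall>Y\<in>A. cx_bracket br X Y \<in> A)"

definition normalizer :: "('u::real_vector \<Rightarrow> 'u \<Rightarrow> 'u) \<Rightarrow> 'u cx set \<Rightarrow> 'u cx set" where
  "normalizer br A = {X. \<forall>Y\<in>A. cx_bracket br X Y \<in> A}"

primrec lower_central :: "('u::real_vector \<Rightarrow> 'u \<Rightarrow> 'u) \<Rightarrow> 'u cx set \<Rightarrow> nat \<Rightarrow> 'u cx set" where
  "lower_central br A 0 = A"
| "lower_central br A (Suc n) =
     cx.span {cx_bracket br X Y | X Y. X \<in> A \<and> Y \<in> lower_central br A n}"

definition cartan_subalgebra :: "('u::real_vector \<Rightarrow> 'u \<Rightarrow> 'u) \<Rightarrow> 'u cx set \<Rightarrow> bool" where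
  "cartan_subalgebra br h \<longleftrightarrow>
     cx_subalgebra br h \<and> (\<exists>n. lower_central br h n = {0}) \<and> normalizer br h = h"

text \<open>Functionals on a subspace \<open>h\<close> are represented by functions vanishing outside \<open>h\<close>,
  so that they add and subtract pointwise and are equal iff they agree on \<open>h\<close>.\<close>

definition cx_dual :: "'u::real_vector cx set \<Rightarrow> ('u cx \<Rightarrow> complex) set" where
  "cx_dual h = {\<alpha>. (\<forall>X\<in>h. \<forall>Y\<in>h. \<alpha> (X + Y) = \<alpha> X + \<alpha> Y) \<and>
                   (\<forall>c. \<forall>X\<in>h. \<alpha> (c *\<^sub>C X) = c * \<alpha> X) \<and> (\<forall>X. X \<notin> h \<longrightarrow> \<alpha> X = 0)}"

definition root_space ::
    "('u::real_vector \<Rightarrow> 'u \<Rightarrow> 'u) \<Rightarrow> 'u cx set \<Rightarrow> ('u cx \<Rightarrow> complex) \<Rightarrow> 'u cx set" where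
  "root_space br h \<alpha> = {X. \<forall>H\<in>h. cx_bracket br H X = \<alpha> H *\<^sub>C X}"

definition roots ::
    "('u::real_vector \<Rightarrow> 'u \<Rightarrow> 'u) \<Rightarrow> 'u cx set \<Rightarrow> ('u cx \<Rightarrow> complex) set" where
  "roots br h = {\<alpha> \<in> cx_dual h. \<alpha> \<noteq> 0 \<and> root_space br h \<alpha> \<noteq> {0}}"

definition coroot ::
    "('u::real_vector \<Rightarrow> 'u \<Rightarrow> 'u) \<Rightarrow> 'u cx set \<Rightarrow> ('u cx \<Rightarrow> complex) \<Rightarrow> 'u cx" where
  "coroot br h \<alpha> =
     (THE H. H \<in> cx.span {cx_bracket br X Y | X Y.
                 X \<in> root_space br h \<alpha> \<and> Y \<in> root_space br h (- \<alpha>)} \<and> \<alpha> H = 2)"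

definition root_reflection ::
    "('u::real_vector \<Rightarrow> 'u \<Rightarrow> 'u) \<Rightarrow> 'u cx set \<Rightarrow> ('u cx \<Rightarrow> complex) \<Rightarrow>
     ('u cx \<Rightarrow> complex) \<Rightarrow> ('u cx \<Rightarrow> complex)" where
  "root_reflection br h \<gamma> \<alpha> = (\<lambda>X. \<alpha> X - \<alpha> (coroot br h \<gamma>) * \<gamma> X)"

definition positive_system :: "('v::ab_group_add) set \<Rightarrow> 'v set \<Rightarrow> bool" where
  "positive_system \<Delta> P \<longleftrightarrow>
     \<Delta> = P \<union> uminus ` P \<and> P \<inter> uminus ` P = {} \<and>
     (\<forall>\<alpha>\<in>P. \<forall>\<beta>\<in>P. \<alpha> + \<beta> \<in> \<Delta> \<longrightarrow> \<alpha> + \<beta> \<in> P)"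

definition Phi :: "('v::ab_group_add) set \<Rightarrow> 'v \<Rightarrow> 'v set" where
  "Phi P \<gamma> = {\<alpha> \<in> P. \<gamma> - \<alpha> \<in> P}"

definition is_stem :: "('v::ab_group_add) set \<Rightarrow> 'v set \<Rightarrow> bool" where
  "is_stem P \<Gamma> \<longleftrightarrow>
     P = \<Gamma> \<union> (\<Union>\<gamma>\<in>\<Gamma>. Phi P \<gamma>) \<and>
     (\<forall>\<gamma>\<in>\<Gamma>. \<Gamma> \<inter> Phi P \<gamma> = {}) \<and>
     (\<forall>\<gamma>\<in>\<Gamma>. \<forall>\<delta>\<in>\<Gamma>. \<gamma> \<noteq> \<delta> \<longrightarrow> Phi P \<gamma> \<inter> Phi P \<delta> = {})"

text \<open>When \<open>\<alpha>\<close>, \<open>\<beta>\<close> and \<open>\<alpha> + \<beta>\<close> are roots, \<open>\<beta> \<noteq> \<plusminus>\<alpha>\<close>, so zero does not occur in the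
  \<open>\<alpha>\<close>-series of \<open>\<beta>\<close>.\<close>

definition weyl_chevalley_basis ::
    "('u::real_vector \<Rightarrow> 'u \<Rightarrow> 'u) \<Rightarrow> 'u cx set \<Rightarrow> (('u cx \<Rightarrow> complex) \<Rightarrow> 'u cx) \<Rightarrow>
     (('u cx \<Rightarrow> complex) \<Rightarrow> ('u cx \<Rightarrow> complex) \<Rightarrow> int) \<Rightarrow> bool" where
  "weyl_chevalley_basis br h E N \<longleftrightarrow>
     (\<forall>\<alpha>\<in>roots br h.
        E \<alpha> \<in> root_space br h \<alpha> \<and>
        cx_bracket br (E \<alpha>) (E (- \<alpha>)) = coroot br h \<alpha> \<and>
        cx_conj (E \<alpha>) = - E (- \<alpha>) \<and>
        cx_conj (coroot br h \<alpha>) = - coroot br h \<alpha>) \<and>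
     (\<forall>\<alpha>\<in>roots br h. \<forall>\<beta>\<in>roots br h. \<alpha> + \<beta> \<in> roots br h \<longrightarrow>
        cx_bracket br (E \<alpha>) (E \<beta>) = of_int (N \<alpha> \<beta>) *\<^sub>C E (\<alpha> + \<beta>) \<and>
        N \<alpha> \<beta> = - N (- \<alpha>) (- \<beta>) \<and>
        (\<exists>p\<^sub>0 q\<^sub>0 :: int.
           (\<forall>n. (\<lambda>X. \<beta> X + of_int n * \<alpha> X) \<in> roots br h \<longleftrightarrow> p\<^sub>0 \<le> n \<and> n \<le> q\<^sub>0) \<and>
           \<bar>N \<alpha> \<beta>\<bar> = 1 - p\<^sub>0))"

definition n_plus ::
    "('u::real_vector \<Rightarrow> 'u \<Rightarrow> 'u) \<Rightarrow> 'u cx set \<Rightarrow> ('u cx \<Rightarrow> complex) set \<Rightarrow> 'u cx set" where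
  "n_plus br h P = cx.span (\<Union>\<alpha>\<in>P. root_space br h \<alpha>)"

definition b_plus ::
    "('u::real_vector \<Rightarrow> 'u \<Rightarrow> 'u) \<Rightarrow> 'u cx set \<Rightarrow> ('u cx \<Rightarrow> complex) set \<Rightarrow> 'u cx set" where
  "b_plus br h P = {H + X | H X. H \<in> h \<and> X \<in> n_plus br h P}"

definition complex_structure :: "('u::real_vector \<Rightarrow> 'u) \<Rightarrow> bool" where
  "complex_structure I \<longleftrightarrow> linear I \<and> (\<forall>x. I (I x) = - x)"

definition m_plus :: "('u::real_vector \<Rightarrow> 'u) \<Rightarrow> 'u cx set" where
  "m_plus I = {X. cx_extend I X = \<i> *\<^sub>C X}"

definition integrable_complex_structure ::
    "('u::real_vector \<Rightarrow> 'u \<Rightarrow> 'u) \<Rightarrow> ('u \<Rightarrow> 'u) \<Rightarrow> bool" where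
  "integrable_complex_structure br I \<longleftrightarrow> complex_structure I \<and> cx_subalgebra br (m_plus I)"

definition b_plus_complex_structure ::
    "('u::real_vector \<Rightarrow> 'u \<Rightarrow> 'u) \<Rightarrow> 'u cx set \<Rightarrow> ('u cx \<Rightarrow> complex) set \<Rightarrow>
     ('u \<Rightarrow> 'u) \<Rightarrow> bool" where
  "b_plus_complex_structure br h P I \<longleftrightarrow>
     integrable_complex_structure br I \<and> normalizer br (m_plus I) = b_plus br h P"

definition hypercomplex_structure ::
    "('u::real_vector \<Rightarrow> 'u \<Rightarrow> 'u) \<Rightarrow> ('u \<Rightarrow> 'u) \<Rightarrow> ('u \<Rightarrow> 'u) \<Rightarrow> bool" where
  "hypercomplex_structure br I J \<longleftrightarrow>
     integrable_complex_structure br I \<and> integrable_complex_structure br J \<and>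
     (\<forall>x. I (J x) = - J (I x))"

definition matches ::
    "('u::real_vector \<Rightarrow> 'u \<Rightarrow> 'u) \<Rightarrow> ('u \<Rightarrow> 'u) \<Rightarrow> ('u \<Rightarrow> 'u) \<Rightarrow> bool" where
  "matches br J I \<longleftrightarrow> integrable_complex_structure br J \<and> (\<forall>x. I (J x) = - J (I x))"

definition admissible :: "('u::real_vector \<Rightarrow> 'u \<Rightarrow> 'u) \<Rightarrow> ('u \<Rightarrow> 'u) \<Rightarrow> bool" where
  "admissible br I \<longleftrightarrow> (\<exists>J. matches br J I)"

definition hypercomplex_equivalent ::
    "('u::real_vector \<Rightarrow> 'u \<Rightarrow> 'u) \<Rightarrow> ('u \<Rightarrow> 'u) \<times> ('u \<Rightarrow> 'u) \<Rightarrow>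
     ('u \<Rightarrow> 'u) \<times> ('u \<Rightarrow> 'u) \<Rightarrow> bool" where
  "hypercomplex_equivalent br = (\<lambda>(I, J) (I', J').
     \<exists>\<xi>. lie_automorphism br \<xi> \<and> \<xi> \<circ> I = I' \<circ> \<xi> \<and> \<xi> \<circ> J = J' \<circ> \<xi>)"

definition W_vec ::
    "('u::real_vector \<Rightarrow> 'u \<Rightarrow> 'u) \<Rightarrow> 'u cx set \<Rightarrow> ('u cx \<Rightarrow> complex) \<Rightarrow> 'u cx" where
  "W_vec br h \<gamma> = (\<i> / 2) *\<^sub>C coroot br h \<gamma>"

definition Z_vec ::
    "('u::real_vector \<Rightarrow> 'u \<Rightarrow> 'u) \<Rightarrow> 'u cx set \<Rightarrow> ('u \<Rightarrow> 'u) \<Rightarrow>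
     ('u cx \<Rightarrow> complex) \<Rightarrow> 'u cx" where
  "Z_vec br h I \<gamma> = cx_extend I (W_vec br h \<gamma>)"

definition Q_vec ::
    "('u::real_vector \<Rightarrow> 'u \<Rightarrow> 'u) \<Rightarrow> 'u cx set \<Rightarrow> ('u \<Rightarrow> 'u) \<Rightarrow>
     ('u cx \<Rightarrow> complex) \<Rightarrow> 'u cx" where
  "Q_vec br h I \<gamma> = W_vec br h \<gamma> + \<i> *\<^sub>C Z_vec br h I \<gamma>"

definition stem_annihilator ::
    "'u::real_vector cx set \<Rightarrow> ('u cx \<Rightarrow> complex) set \<Rightarrow> 'u cx set" where
  "stem_annihilator h \<Gamma> = {H \<in> h. \<forall>\<gamma>\<in>\<Gamma>. \<gamma> H = 0}"

definition h_plus :: "'u::real_vector cx set \<Rightarrow> ('u \<Rightarrow> 'u) \<Rightarrow> 'u cx set" where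
  "h_plus h I = h \<inter> m_plus I"

definition j_plus ::
    "'u::real_vector cx set \<Rightarrow> ('u cx \<Rightarrow> complex) set \<Rightarrow> ('u \<Rightarrow> 'u) \<Rightarrow> 'u cx set" where
  "j_plus h \<Gamma> I = stem_annihilator h \<Gamma> \<inter> h_plus h I"

end

(*
  Write m+ and m- for the i- and (-i)-eigenspaces of I.  Since b+ normalizes m+, both are stable
  under ad h.  Integrability of an anticommuting J says that J, taken modulo m+, is a 1-cocycle of
  m+ with values in g/m+, which is identified with m-.  The weights of h+ on m+ and on g/m+ force
  this cocycle to be inner up to a map h+ -> h-: there is V = sum of v_alpha E_(-alpha) over the
  positive roots with J E_beta = [V, E_beta] mod m+.

  J^2 = -1 and the commutation of J with tau then determine V.  Going down from the highest
  roots, cnj(v_gamma) v_alpha alpha((H_gamma)_+) is 1 for alpha = gamma and 0 otherwise, for every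
  gamma in the stem.  As Re alpha((H_gamma)_+) = alpha(H_gamma)/2 > 0 for alpha in Phi_gamma, V is
  supported on the stem, the coefficients there have modulus 1, and the stem is orthogonal.  A
  torus element, which commutes with I, rotates every v_gamma to -i.
*)
theory Submission
  imports Defs
begin

text \<open>Positivity of the Hermitian form extending the invariant inner product stands in for the
  semisimple structure theory and tolerates a centre. Even the root decomposition is read off from
  I: g is the sum of m+ and its conjugate, and m+ lies in b+. No cohomology theory is needed for V:
  a positive root \<beta> never agrees on h+ with a weight -\<alpha> or 0 of g/m+, because \<alpha>
  + \<beta> and \<beta> are nonzero there. The relation for cnj(v_gamma) v_alpha arises from J^2 =
  -1 on E_gamma. It needs J E_gamma to be a multiple of tau((H_gamma)_+), which holds once no root
  above gamma carries a coefficient; hence the descending order. The imaginary part of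
  alpha((H_gamma)_+) depends on I, so only the real part is at hand, and its positivity suffices to
  kill v_alpha. Orthogonality of the stem thus comes out of J, and it is what lets the phases be
  rotated independently. The target -i is dictated by Q_gamma = -i tau((H_gamma)_+).\<close>

declare split_paired_All [simp del] split_paired_Ex [simp del]

section \<open>Complexified Lie algebra\<close>

lemma cx_conj_add: "cx_conj (X + Y) = cx_conj X + cx_conj Y"
  and cx_conj_diff: "cx_conj (X - Y) = cx_conj X - cx_conj Y"
  and cx_conj_minus: "cx_conj (- X) = - cx_conj X"
  and cx_conj_scale: "cx_conj (c *\<^sub>C X) = cnj c *\<^sub>C cx_conj X"
  and cx_conj_conj [simp]: "cx_conj (cx_conj X) = X"
  and cx_conj_zero [simp]: "cx_conj 0 = 0"
  by (simp_all add: cx_conj_def cx_scale_def prod_eq_iff)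

lemma cx_conj_sum: "cx_conj (sum f A) = (\<Sum>a\<in>A. cx_conj (f a))"
  by (induction A rule: infinite_finite_induct) (simp_all add: cx_conj_add)

lemma cx_extend_add: "linear f \<Longrightarrow> cx_extend f (X + Y) = cx_extend f X + cx_extend f Y"
  and cx_extend_diff: "linear f \<Longrightarrow> cx_extend f (X - Y) = cx_extend f X - cx_extend f Y"
  and cx_extend_minus: "linear f \<Longrightarrow> cx_extend f (- X) = - cx_extend f X"
  and cx_extend_zero: "linear f \<Longrightarrow> cx_extend f 0 = 0"
  and cx_extend_scale: "linear f \<Longrightarrow> cx_extend f (c *\<^sub>C X) = c *\<^sub>C cx_extend f X"
  and cx_extend_conj: "linear f \<Longrightarrow> cx_extend f (cx_conj X) = cx_conj (cx_extend f X)"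
  by (simp_all add: cx_extend_def cx_conj_def cx_scale_def prod_eq_iff linear_add linear_diff
      linear_neg linear_0 linear_scale)

lemma cx_extend_comp: "cx_extend (f \<circ> g) X = cx_extend f (cx_extend g X)"
  by (simp add: cx_extend_def)

lemma cx_extend_sum: "linear f \<Longrightarrow> cx_extend f (sum g A) = (\<Sum>a\<in>A. cx_extend f (g a))"
  by (induction A rule: infinite_finite_induct) (simp_all add: cx_extend_add cx_extend_zero)

lemma complex_structure_cx_extend:
  "complex_structure J \<Longrightarrow> cx_extend J (cx_extend J X) = - X"
  by (simp add: complex_structure_def cx_extend_def prod_eq_iff)

context real_lie_algebra
begin

abbreviation lie :: "'u cx \<Rightarrow> 'u cx \<Rightarrow> 'u cx" where
  "lie \<equiv> cx_bracket br"

lemma br_linear: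
  "br (x + y) z = br x z + br y z" "br z (x + y) = br z x + br z y"
  "br (x - y) z = br x z - br y z" "br z (x - y) = br z x - br z y"
  "br (- x) z = - br x z" "br z (- x) = - br z x"
  "br (r *\<^sub>R x) z = r *\<^sub>R br x z" "br z (r *\<^sub>R x) = r *\<^sub>R br z x"
  "br 0 z = 0" "br z 0 = 0"
  using bilinear_br
  by (simp_all add: bilinear_ladd bilinear_radd bilinear_lsub bilinear_rsub bilinear_lneg
      bilinear_rneg bilinear_lmul bilinear_rmul bilinear_lzero bilinear_rzero)

lemma br_antisym: "br x y = - br y x"
proof -
  have "br x y + br y x = 0"
    using br_self[of "x + y"] unfolding br_linear by (simp add: br_self add.commute)
  then show ?thesis by (rule eq_neg_iff_add_eq_0[THEN iffD2])
qed

lemma lie_linear: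
  "lie (X + Y) Z = lie X Z + lie Y Z" "lie Z (X + Y) = lie Z X + lie Z Y"
  "lie (X - Y) Z = lie X Z - lie Y Z" "lie Z (X - Y) = lie Z X - lie Z Y"
  "lie (- X) Z = - lie X Z" "lie Z (- X) = - lie Z X"
  "lie (c *\<^sub>C X) Z = c *\<^sub>C lie X Z" "lie Z (c *\<^sub>C X) = c *\<^sub>C lie Z X"
  "lie 0 Z = 0" "lie Z 0 = 0"
  by (simp_all add: cx_bracket_def cx_scale_def br_linear prod_eq_iff algebra_simps)

lemma lie_sum: "lie (sum f A) Z = (\<Sum>a\<in>A. lie (f a) Z)" "lie Z (sum f A) = (\<Sum>a\<in>A. lie Z (f a))"
  by (induction A rule: infinite_finite_induct) (simp_all add: lie_linear)

lemma lie_antisym: "lie X Y = - lie Y X"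
  using br_antisym[of "fst X" "fst Y"] br_antisym[of "snd X" "snd Y"]
    br_antisym[of "fst X" "snd Y"] br_antisym[of "snd X" "fst Y"]
  by (simp add: cx_bracket_def prod_eq_iff)

lemma lie_jacobi: "lie X (lie Y Z) = lie (lie X Y) Z + lie Y (lie X Z)"
proof -
  have 1: "br x (br y z) = br (br x y) z + br y (br x z)" for x y z
    using jacobi[of x y z] br_antisym[of z "br x y"] br_antisym[of z x]
    by (simp add: br_linear algebra_simps add_eq_0_iff)
  show ?thesis
    by (simp add: cx_bracket_def br_linear prod_eq_iff algebra_simps
        1[of "fst X" "fst Y" "fst Z"] 1[of "fst X" "fst Y" "snd Z"]
        1[of "fst X" "snd Y" "fst Z"] 1[of "fst X" "snd Y" "snd Z"]
        1[of "snd X" "fst Y" "fst Z"] 1[of "snd X" "fst Y" "snd Z"]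
        1[of "snd X" "snd Y" "fst Z"] 1[of "snd X" "snd Y" "snd Z"])
qed

lemma cx_conj_lie: "cx_conj (lie X Y) = lie (cx_conj X) (cx_conj Y)"
  by (simp add: cx_bracket_def cx_conj_def br_linear prod_eq_iff)

text \<open>An element of m+ has the form x - iJx with x real, so closure of m+ under brackets
  becomes the vanishing of the Nijenhuis tensor, an identity over the real algebra.\<close>

lemma integrable_iff:
  assumes "complex_structure J"
  shows "integrable_complex_structure br J \<longleftrightarrow>
    (\<forall>x y. J (br x y - br (J x) (J y)) = br x (J y) + br (J x) y)"
proof -
  have lin: "linear J" and JJ: "\<And>x. J (J x) = - x"
    using assms by (auto simp: complex_structure_def)
  have mem: "X \<in> m_plus J \<longleftrightarrow> snd X = - J (fst X)" for X
    by (auto simp: m_plus_def cx_extend_def cx_scale_def prod_eq_iff JJ linear_neg[OF lin])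
  have sub: "cx.subspace (m_plus J)"
    by (rule cx.subspaceI)
       (auto simp: mem cx_scale_def linear_0[OF lin] linear_add[OF lin] linear_diff[OF lin]
         linear_scale[OF lin] linear_neg[OF lin] JJ algebra_simps)
  have all: "(\<forall>X\<in>m_plus J. \<forall>Y\<in>m_plus J. Q X Y) \<longleftrightarrow> (\<forall>x y. Q (x, - J x) (y, - J y))" for Q
    by (auto simp: mem)
  have "integrable_complex_structure br J \<longleftrightarrow>
      (\<forall>X\<in>m_plus J. \<forall>Y\<in>m_plus J. lie X Y \<in> m_plus J)"
    by (simp add: integrable_complex_structure_def cx_subalgebra_def assms sub)
  also have "\<dots> \<longleftrightarrow> (\<forall>x y. lie (x, - J x) (y, - J y) \<in> m_plus J)"
    by (rule all)
  also have "\<dots> \<longleftrightarrow> (\<forall>x y. J (br x y - br (J x) (J y)) = br x (J y) + br (J x) y)"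
  proof -
    have "lie (x, - J x) (y, - J y) \<in> m_plus J \<longleftrightarrow>
        - (br x (J y) + br (J x) y) = - J (br x y - br (J x) (J y))" for x y
      by (simp add: mem cx_bracket_def br_linear)
    then show ?thesis by (metis neg_equal_iff_equal)
  qed
  finally show ?thesis .
qed

text \<open>Both sides are complex bilinear, so the real identity extends; it applies to vectors
  outside the eigenspaces of \<open>J\<close>, in particular to those of m+ of another
  structure.\<close>

lemma integrable_cx:
  assumes "integrable_complex_structure br J"
  shows "cx_extend J (lie X Y - lie (cx_extend J X) (cx_extend J Y)) =
    lie X (cx_extend J Y) + lie (cx_extend J X) Y"
proof -
  have cs: "complex_structure J" using assms by (simp add: integrable_complex_structure_def)
  then have lin: "linear J" by (simp add: complex_structure_def)
  have 1: "J (br x y) = J (br (J x) (J y)) + br x (J y) + br (J x) y" for x y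
    using assms[unfolded integrable_iff[OF cs], rule_format, of x y]
    by (simp add: linear_diff[OF lin] algebra_simps)
  show ?thesis
    by (simp add: cx_extend_def cx_bracket_def prod_eq_iff linear_add[OF lin] linear_diff[OF lin]
        1[of "fst X"] 1[of "snd X"])
qed

lemma integrable_conjugate:
  assumes J: "integrable_complex_structure br J" and xi: "lie_automorphism br \<xi>"
    and eta: "\<xi> \<circ> \<eta> = id" "\<eta> \<circ> \<xi> = id"
  shows "integrable_complex_structure br (\<xi> \<circ> J \<circ> \<eta>)"
proof -
  have lin: "linear \<xi>" and hom: "\<And>x y. \<xi> (br x y) = br (\<xi> x) (\<xi> y)"
    using xi by (auto simp: lie_automorphism_def)
  have inv [simp]: "\<xi> (\<eta> x) = x" "\<eta> (\<xi> x) = x" for x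
    using eta by (simp_all add: fun_eq_iff)
  have inj: "\<eta> x = y \<longleftrightarrow> x = \<xi> y" for x y by auto
  have lin': "linear \<eta>"
    by (rule linearI) (simp_all add: inj linear_add[OF lin] linear_scale[OF lin])
  have hom': "\<eta> (br x y) = br (\<eta> x) (\<eta> y)" for x y
    by (simp add: inj hom)
  have cs: "complex_structure J" using J by (simp add: integrable_complex_structure_def)
  then have linJ: "linear J" and JJ: "\<And>x. J (J x) = - x"
    by (auto simp: complex_structure_def)
  have cs': "complex_structure (\<xi> \<circ> J \<circ> \<eta>)"
    using linear_compose[OF linear_compose[OF lin' linJ] lin] by (simp add: complex_structure_def JJ linear_neg[OF lin] o_assoc)
  show ?thesis
    unfolding integrable_iff[OF cs']
  proof (intro allI)
    fix x y
    have "(\<xi> \<circ> J \<circ> \<eta>) (br x y - br ((\<xi> \<circ> J \<circ> \<eta>) x) ((\<xi> \<circ> J \<circ> \<eta>) y)) =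
      \<xi> (J (br (\<eta> x) (\<eta> y) - br (J (\<eta> x)) (J (\<eta> y))))"
      by (simp add: linear_diff[OF lin'] hom')
    also have "\<dots> = \<xi> (br (\<eta> x) (J (\<eta> y)) + br (J (\<eta> x)) (\<eta> y))"
      using J[unfolded integrable_iff[OF cs]] by simp
    also have "\<dots> = br x ((\<xi> \<circ> J \<circ> \<eta>) y) + br ((\<xi> \<circ> J \<circ> \<eta>) x) y"
      by (simp add: linear_add[OF lin] hom)
    finally show "(\<xi> \<circ> J \<circ> \<eta>) (br x y - br ((\<xi> \<circ> J \<circ> \<eta>) x) ((\<xi> \<circ> J \<circ> \<eta>) y)) =
      br x ((\<xi> \<circ> J \<circ> \<eta>) y) + br ((\<xi> \<circ> J \<circ> \<eta>) x) y" .
  qed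
qed

end

section \<open>The invariant Hermitian form and the root spaces\<close>

locale invariant_form = real_lie_algebra br for br :: "'u::real_vector \<Rightarrow> 'u \<Rightarrow> 'u" +
  fixes ip :: "'u \<Rightarrow> 'u \<Rightarrow> real"
  assumes ip_bilinear: "bilinear ip"
    and ip_sym: "ip x y = ip y x"
    and ip_pos: "x \<noteq> 0 \<Longrightarrow> ip x x > 0"
    and ip_invariant: "ip (br x y) z = ip x (br y z)"
    and finite_dimensional: "\<exists>B :: 'u set. finite B \<and> span B = UNIV"
begin

text \<open>The Hermitian extension of \<open>ip\<close>, linear in the first and conjugate linear
  in the second argument.\<close>

definition hm :: "'u cx \<Rightarrow> 'u cx \<Rightarrow> complex" where
  "hm X Y = Complex (ip (fst X) (fst Y) + ip (snd X) (snd Y)) (ip (snd X) (fst Y) - ip (fst X) (snd Y))"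

lemma ip_linear:
  "ip (x + y) z = ip x z + ip y z" "ip z (x + y) = ip z x + ip z y"
  "ip (x - y) z = ip x z - ip y z" "ip z (x - y) = ip z x - ip z y"
  "ip (- x) z = - ip x z" "ip z (- x) = - ip z x"
  "ip (r *\<^sub>R x) z = r * ip x z" "ip z (r *\<^sub>R x) = r * ip z x"
  "ip 0 z = 0" "ip z 0 = 0"
  using ip_bilinear
  by (simp_all add: bilinear_ladd bilinear_radd bilinear_lsub bilinear_rsub bilinear_lneg
      bilinear_rneg bilinear_lmul bilinear_rmul bilinear_lzero bilinear_rzero)

lemma hm_linear:
  "hm (X + Y) Z = hm X Z + hm Y Z" "hm Z (X + Y) = hm Z X + hm Z Y"
  "hm (X - Y) Z = hm X Z - hm Y Z" "hm Z (X - Y) = hm Z X - hm Z Y"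
  "hm (- X) Z = - hm X Z" "hm Z (- X) = - hm Z X"
  "hm (c *\<^sub>C X) Z = c * hm X Z" "hm Z (c *\<^sub>C X) = cnj c * hm Z X"
  "hm 0 Z = 0" "hm Z 0 = 0"
  by (simp_all add: hm_def ip_linear cx_scale_def complex_eq_iff algebra_simps)

lemma hm_sum: "hm (sum f A) Z = (\<Sum>a\<in>A. hm (f a) Z)"
  by (induction A rule: infinite_finite_induct) (simp_all add: hm_linear)

lemma hm_conj: "hm (cx_conj X) (cx_conj Y) = cnj (hm X Y)"
  by (simp add: hm_def cx_conj_def complex_eq_iff ip_linear)

lemma hm_self: "X \<noteq> 0 \<Longrightarrow> Re (hm X X) > 0" "Im (hm X X) = 0"
proof -
  have "ip x x \<ge> 0" for x by (cases "x = 0") (auto simp: ip_linear dest: ip_pos)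
  then show "X \<noteq> 0 \<Longrightarrow> Re (hm X X) > 0"
    by (cases "fst X = 0") (auto simp: hm_def prod_eq_iff ip_pos add_pos_nonneg add_nonneg_pos)
  show "Im (hm X X) = 0" by (simp add: hm_def ip_sym)
qed

lemma hm_self_0 [simp]: "hm X X = 0 \<longleftrightarrow> X = 0"
  using hm_self(1)[of X] by (cases "X = 0") (simp_all add: hm_linear complex_eq_iff)

text \<open>The adjoint of ad Z is -ad(tau Z), since real elements act by skew maps.\<close>

lemma hm_invariant: "hm (lie Z X) Y = - hm X (lie (cx_conj Z) Y)"
proof -
  have 1: "ip (br z x) y = - ip x (br z y)" for x y z
    using ip_invariant[of x z y] br_antisym[of z x] by (simp add: ip_linear)
  show ?thesis
    by (simp add: hm_def cx_bracket_def cx_conj_def ip_linear br_linear complex_eq_iff 1)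
qed

lemma cx_finite_dim: "\<exists>B :: 'u cx set. finite B \<and> cx.span B = UNIV"
proof -
  obtain B :: "'u set" where B: "finite B" "span B = UNIV" using finite_dimensional by blast
  let ?B = "(\<lambda>x. (x, 0)) ` B :: 'u cx set"
  have sub: "cx.subspace (cx.span ?B)" by (rule cx.subspace_span)
  have real: "(x, 0) \<in> cx.span ?B" for x
  proof -
    have "x \<in> span B" using B by simp
    then show ?thesis
    proof (induction rule: span_induct_alt)
      case base
      show ?case using cx.subspace_0[OF sub] by (simp add: zero_prod_def)
    next
      case (step c x y)
      have "complex_of_real c *\<^sub>C (x, 0) + (y, 0) \<in> cx.span ?B"
        by (rule cx.span_add[OF cx.span_scale[OF cx.span_base[OF imageI]]]) (use step in auto)
      moreover have "complex_of_real c *\<^sub>C (x, 0) + (y, 0) = (c *\<^sub>R x + y, 0)"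
        by (simp add: cx_scale_def)
      ultimately show ?case by simp
    qed
  qed
  have "X \<in> cx.span ?B" for X
  proof -
    have "(fst X, 0) + \<i> *\<^sub>C (snd X, 0) \<in> cx.span ?B"
      by (intro cx.span_add cx.span_scale real)
    moreover have "(fst X, 0) + \<i> *\<^sub>C (snd X, 0) = X" by (simp add: cx_scale_def)
    ultimately show ?thesis by simp
  qed
  then show ?thesis using B(1) by blast
qed

text \<open>Orthogonal nonzero vectors are independent; applied to the \<open>E \<alpha>\<close>
  this makes the root system finite.\<close>

lemma finite_orthogonal:
  assumes nz: "\<And>X. X \<in> A \<Longrightarrow> X \<noteq> 0"
    and orth: "\<And>X Y. X \<in> A \<Longrightarrow> Y \<in> A \<Longrightarrow> X \<noteq> Y \<Longrightarrow> hm X Y = 0"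
  shows "finite A"
proof -
  have "cx.independent A"
    unfolding cx.independent_explicit_module
  proof (intro allI impI)
    fix t u v
    assume t: "finite t" "t \<subseteq> A" "(\<Sum>v\<in>t. u v *\<^sub>C v) = 0" "v \<in> t"
    have "0 = hm (\<Sum>v\<in>t. u v *\<^sub>C v) v" using t(3) by (simp add: hm_linear)
    also have "\<dots> = (\<Sum>w\<in>t. u w * hm w v)" by (simp add: hm_sum hm_linear)
    also have "\<dots> = (\<Sum>w\<in>{v}. u w * hm w v)"
      using t by (intro sum.mono_neutral_right) (auto intro: orth)
    finally show "u v = 0" using nz[of v] t by auto
  qed
  moreover obtain B :: "'u cx set" where "finite B" "cx.span B = UNIV" using cx_finite_dim by blast
  ultimately show ?thesis using cx.independent_span_bound[of B A] by auto
qed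

end

section \<open>Weights of the Cartan subalgebra, root spaces and coroots\<close>

locale cartan_data = invariant_form br ip
  for br :: "'u::real_vector \<Rightarrow> 'u \<Rightarrow> 'u" and ip +
  fixes h :: "'u cx set"
  assumes cartan: "cartan_subalgebra br h" and conj_h: "cx_conj ` h = h"
begin

abbreviation "\<Delta> \<equiv> roots br h"
abbreviation "rs \<equiv> root_space br h"
abbreviation "H\<^sub>c \<equiv> coroot br h"

lemma subspace_h: "cx.subspace h"
  using cartan by (simp add: cartan_subalgebra_def cx_subalgebra_def)

lemmas h_closed = cx.subspace_0[OF subspace_h] cx.subspace_add[OF subspace_h]
  cx.subspace_scale[OF subspace_h] cx.subspace_diff[OF subspace_h] cx.subspace_neg[OF subspace_h]
  cx.subspace_sum[OF subspace_h]

lemma conj_in_h: "X \<in> h \<Longrightarrow> cx_conj X \<in> h"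
  using conj_h by blast

text \<open>Such an \<open>X\<close> normalizes \<open>h\<close>, and a Cartan subalgebra is its own
  normalizer.\<close>

lemma centralizer_h: "(\<And>H. H \<in> h \<Longrightarrow> lie H X = 0) \<Longrightarrow> X \<in> h"
proof -
  assume *: "\<And>H. H \<in> h \<Longrightarrow> lie H X = 0"
  have "X \<in> normalizer br h"
    using * lie_antisym[of X] by (auto simp: normalizer_def h_closed)
  then show ?thesis using cartan by (simp add: cartan_subalgebra_def)
qed

text \<open>A real element of \<open>h\<close> acts on \<open>h\<close> by a transformation that is nilpotent and
  skew-Hermitian, hence zero.\<close>

lemma h_abelian:
  assumes "H \<in> h" "X \<in> h"
  shows "lie H X = 0"
proof -
  obtain n where n: "lower_central br h n = {0}"
    using cartan by (auto simp: cartan_subalgebra_def)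
  have real: "lie K X = 0" if K: "K \<in> h" "cx_conj K = K" for K
  proof -
    \<comment> \<open>The squared norm of \<open>lie K Y\<close> is minus the pairing of
      \<open>Y\<close> with \<open>lie K (lie K Y)\<close>, so powers of ad \<open>K\<close> cancel
      down to the first.\<close>
    have skew: "lie K Y = 0" if "lie K (lie K Y) = 0" for Y
      using hm_invariant[of K Y "lie K Y"] that by (simp add: K hm_linear)
    have mem: "(lie K ^^ k) X \<in> lower_central br h k" for k
      by (induction k) (use assms K in \<open>simp, fastforce intro!: cx.span_base\<close>)
    have "(lie K ^^ n) X = 0" using mem[of n] n by simp
    moreover have "lie K X = 0" if "(lie K ^^ k) X = 0" for k
      using that
    proof (induction k)
      case 0 then show ?case by (simp add: lie_linear)
    next
      case (Suc k)
      then show ?case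
        by (cases k) (auto intro: skew)
    qed
    ultimately show ?thesis by blast
  qed
  \<comment> \<open>Real and imaginary part of \<open>H\<close>, both fixed by
    \<open>cx_conj\<close>.\<close>
  let ?K = "(1/2) *\<^sub>C (H + cx_conj H)" and ?L = "(- \<i>/2) *\<^sub>C (H - cx_conj H)"
  have "H = ?K + \<i> *\<^sub>C ?L"
    by (simp add: cx_scale_def cx_conj_def prod_eq_iff algebra_simps flip: scaleR_2)
  moreover have "lie ?K X = 0" "lie ?L X = 0"
    using conj_in_h[OF assms(1)] assms(1)
    by (auto intro!: real h_closed simp: cx_conj_add cx_conj_diff cx_conj_scale cx.scale_right_distrib
        cx.scale_right_diff_distrib cx.scale_minus_left)
  ultimately show ?thesis
    using lie_linear(1)[of ?K "\<i> *\<^sub>C ?L" X] lie_linear(7)[of \<i> ?L X] by simp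
qed

lemma rs_iff: "X \<in> rs \<alpha> \<longleftrightarrow> (\<forall>H\<in>h. lie H X = \<alpha> H *\<^sub>C X)"
  by (simp add: root_space_def)

lemma rsD: "X \<in> rs \<alpha> \<Longrightarrow> H \<in> h \<Longrightarrow> lie H X = \<alpha> H *\<^sub>C X"
  by (simp add: root_space_def)

lemma rs_0: "rs 0 = h"
  using centralizer_h h_abelian by (auto simp: root_space_def)

lemma rs_lie:
  assumes "X \<in> rs \<alpha>" "Y \<in> rs \<beta>"
  shows "lie X Y \<in> rs (\<alpha> + \<beta>)"
  using assms
  by (auto simp: rs_iff lie_jacobi[of _ X Y] lie_linear cx.scale_left_distrib)

lemma dual_add: "\<alpha> \<in> cx_dual h \<Longrightarrow> X \<in> h \<Longrightarrow> Y \<in> h \<Longrightarrow> \<alpha> (X + Y) = \<alpha> X + \<alpha> Y"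
  and dual_scale: "\<alpha> \<in> cx_dual h \<Longrightarrow> X \<in> h \<Longrightarrow> \<alpha> (c *\<^sub>C X) = c * \<alpha> X"
  and dual_outside: "\<alpha> \<in> cx_dual h \<Longrightarrow> X \<notin> h \<Longrightarrow> \<alpha> X = 0"
  by (simp_all add: cx_dual_def)

lemma dual_zero: "\<alpha> \<in> cx_dual h \<Longrightarrow> \<alpha> 0 = 0"
  using dual_scale[of \<alpha> 0 0] h_closed by simp

lemma dual_minus: "\<alpha> \<in> cx_dual h \<Longrightarrow> X \<in> h \<Longrightarrow> \<alpha> (- X) = - \<alpha> X"
  using dual_scale[of \<alpha> X "-1"] by (simp add: cx.scale_minus_left)

lemma dual_sum:
  assumes "\<alpha> \<in> cx_dual h" "\<And>a. a \<in> A \<Longrightarrow> f a \<in> h"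
  shows "\<alpha> (sum f A) = (\<Sum>a\<in>A. \<alpha> (f a))"
  using assms(2)
  by (induction A rule: infinite_finite_induct)
     (auto simp: dual_zero[OF assms(1)] dual_add[OF assms(1)] h_closed)

lemma dual_closed: "\<alpha> \<in> cx_dual h \<Longrightarrow> \<beta> \<in> cx_dual h \<Longrightarrow> \<alpha> + \<beta> \<in> cx_dual h"
  "\<alpha> \<in> cx_dual h \<Longrightarrow> - \<alpha> \<in> cx_dual h" "0 \<in> cx_dual h"
  by (auto simp: cx_dual_def algebra_simps)

lemma root_dual: "\<alpha> \<in> \<Delta> \<Longrightarrow> \<alpha> \<in> cx_dual h"
  and root_nz: "\<alpha> \<in> \<Delta> \<Longrightarrow> \<alpha> \<noteq> 0"
  by (auto simp: roots_def)

lemma dual_ext: "\<alpha> \<in> cx_dual h \<Longrightarrow> \<beta> \<in> cx_dual h \<Longrightarrow> (\<And>H. H \<in> h \<Longrightarrow> \<alpha> H = \<beta> H) \<Longrightarrow> \<alpha> = \<beta>"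
  by (rule ext) (metis dual_outside)

lemma rs_trivial: "\<alpha> \<in> cx_dual h \<Longrightarrow> \<alpha> \<notin> \<Delta> \<Longrightarrow> \<alpha> \<noteq> 0 \<Longrightarrow> rs \<alpha> = {0}"
  by (auto simp: roots_def)

lemma root_space_nz: "\<alpha> \<in> \<Delta> \<Longrightarrow> \<exists>X\<in>rs \<alpha>. X \<noteq> 0"
proof -
  assume "\<alpha> \<in> \<Delta>"
  then have "rs \<alpha> \<noteq> {0}" by (simp add: roots_def)
  moreover have "0 \<in> rs \<alpha>" by (simp add: rs_iff lie_linear)
  ultimately show ?thesis by blast
qed

text \<open>Pair [H, X] with X and move ad H across the form, where it becomes -ad(tau H). So roots
  are imaginary on the conjugation-fixed part of \<open>h\<close>.\<close>

lemma weight_conj: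
  assumes "X \<in> rs \<alpha>" "X \<noteq> 0" "H \<in> h"
  shows "\<alpha> (cx_conj H) = - cnj (\<alpha> H)"
proof -
  have "lie H X = \<alpha> H *\<^sub>C X" "lie (cx_conj H) X = \<alpha> (cx_conj H) *\<^sub>C X"
    using rsD assms conj_in_h by blast+
  then have "\<alpha> H * hm X X = - cnj (\<alpha> (cx_conj H)) * hm X X"
    using hm_invariant[of H X X] by (simp add: hm_linear)
  then have "\<alpha> H = - cnj (\<alpha> (cx_conj H))" using assms(2) by (metis hm_self_0 mult_right_cancel)
  then show ?thesis by simp
qed

lemma root_conj: "\<alpha> \<in> \<Delta> \<Longrightarrow> H \<in> h \<Longrightarrow> \<alpha> (cx_conj H) = - cnj (\<alpha> H)"
  using root_space_nz weight_conj by blast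

lemma rs_conj:
  assumes "X \<in> rs \<alpha>"
  shows "cx_conj X \<in> rs (- \<alpha>)"
proof (cases "X = 0")
  case True then show ?thesis by (simp add: rs_iff lie_linear)
next
  case False
  show ?thesis
    unfolding rs_iff
  proof
    fix H assume H: "H \<in> h"
    have "lie H (cx_conj X) = cx_conj (lie (cx_conj H) X)" by (simp add: cx_conj_lie)
    also have "\<dots> = cx_conj (\<alpha> (cx_conj H) *\<^sub>C X)" using rsD[OF assms] conj_in_h[OF H] by simp
    also have "\<dots> = (- \<alpha>) H *\<^sub>C cx_conj X" 
      by (simp add: cx_conj_scale cx_conj_minus weight_conj[OF assms False H] cx.scale_minus_left)
    finally show "lie H (cx_conj X) = (- \<alpha>) H *\<^sub>C cx_conj X" .
  qed
qed

lemma root_uminus: "\<alpha> \<in> \<Delta> \<Longrightarrow> - \<alpha> \<in> \<Delta>"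
proof -
  assume a: "\<alpha> \<in> \<Delta>"
  obtain X where X: "X \<in> rs \<alpha>" "X \<noteq> 0" using root_space_nz[OF a] by blast
  have "cx_conj X \<noteq> 0" using X by (metis cx_conj_conj cx_conj_zero)
  then show "- \<alpha> \<in> \<Delta>"
    using rs_conj[OF X(1)] dual_closed(2)[OF root_dual[OF a]] root_nz[OF a]
    by (auto simp: roots_def)
qed

text \<open>ad H and ad(tau H) are adjoint up to sign, so weight vectors behave like eigenvectors of
  a normal operator.\<close>

lemma rs_orth:
  assumes "X \<in> rs \<alpha>" "Y \<in> rs \<beta>" "\<alpha> \<in> cx_dual h" "\<beta> \<in> cx_dual h" "\<alpha> \<noteq> \<beta>"
  shows "hm X Y = 0"
proof (cases "Y = 0")
  case True then show ?thesis by (simp add: hm_linear)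
next
  case False
  obtain H where H: "H \<in> h" "\<alpha> H \<noteq> \<beta> H" using dual_ext assms by blast
  have "lie H X = \<alpha> H *\<^sub>C X" "lie (cx_conj H) Y = \<beta> (cx_conj H) *\<^sub>C Y"
    using rsD assms conj_in_h H by blast+
  then have "\<alpha> H * hm X Y = \<beta> H * hm X Y"
    using hm_invariant[of H X Y] by (simp add: hm_linear weight_conj[OF assms(2) False H(1)])
  then show ?thesis using H by simp
qed

text \<open>Paired with \<open>h\<close>, a bracket of vectors of weights \<alpha> and -\<alpha>
  sees them only through one scalar, so all such brackets lie on one line, although root spaces are
  not yet known to be lines. As \<alpha> is nonzero on that line, the description defining
  \<open>coroot\<close> singles out one vector.\<close>

lemma coroot_bracket:
  assumes a: "\<alpha> \<in> \<Delta>"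
  shows "H\<^sub>c \<alpha> \<in> h" "\<alpha> (H\<^sub>c \<alpha>) = 2"
    and "X \<in> rs \<alpha> \<Longrightarrow> Y \<in> rs (- \<alpha>) \<Longrightarrow> lie X Y = (\<alpha> (lie X Y) / 2) *\<^sub>C H\<^sub>c \<alpha>"
proof -
  have ad: "\<alpha> \<in> cx_dual h" by (rule root_dual[OF a])
  obtain X\<^sub>0 where X0: "X\<^sub>0 \<in> rs \<alpha>" "X\<^sub>0 \<noteq> 0" using root_space_nz[OF a] by blast
  define Y\<^sub>0 where "Y\<^sub>0 = cx_conj X\<^sub>0"
  have Y0: "Y\<^sub>0 \<in> rs (- \<alpha>)" using rs_conj[OF X0(1)] by (simp add: Y\<^sub>0_def)
  have Y0n: "Y\<^sub>0 \<noteq> 0" using X0 by (metis Y\<^sub>0_def cx_conj_conj cx_conj_zero)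
  define K where "K = lie X\<^sub>0 Y\<^sub>0"
  have in_h: "lie X Y \<in> h" if "X \<in> rs \<alpha>" "Y \<in> rs (- \<alpha>)" for X Y
    using rs_lie[OF that] by (simp add: rs_0)
  have Kh: "K \<in> h" unfolding K_def by (rule in_h[OF X0(1) Y0])
  have pair: "hm (lie X Y) H = - cnj (\<alpha> H) * hm Y (cx_conj X)"
    if "X \<in> rs \<alpha>" "H \<in> h" for X Y H
  proof -
    have "lie (cx_conj X) H = \<alpha> H *\<^sub>C cx_conj X"
      using rsD[OF rs_conj[OF that(1)] that(2)] lie_antisym[of "cx_conj X" H]
      by (simp add: cx.scale_minus_left)
    then show ?thesis by (simp add: hm_invariant hm_linear)
  qed
  have multiple: "\<exists>c. lie X Y = c *\<^sub>C K" if X: "X \<in> rs \<alpha>" and Y: "Y \<in> rs (- \<alpha>)" for X Y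
  proof -
    \<comment> \<open>The ratio of the scalars that \<open>pair\<close> attaches to
      \<open>X\<close>, \<open>Y\<close> and to the reference vectors.\<close>
    define c where "c = hm Y (cx_conj X) / hm Y\<^sub>0 Y\<^sub>0"
    have "hm (lie X Y - c *\<^sub>C K) H = 0" if "H \<in> h" for H
      using pair[OF X that, of Y] pair[OF X0(1) that, of Y\<^sub>0] Y0n
      by (simp add: hm_linear K_def c_def Y\<^sub>0_def)
    moreover have "lie X Y - c *\<^sub>C K \<in> h" using in_h[OF X Y] Kh h_closed by blast
    ultimately have "lie X Y - c *\<^sub>C K = 0" by (metis hm_self_0)
    then have "lie X Y = c *\<^sub>C K" by simp
    then show ?thesis ..
  qed
  obtain H where H: "H \<in> h" "\<alpha> H \<noteq> 0"
    using dual_ext[OF ad dual_closed(3)] root_nz[OF a] by auto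
  have "hm K H \<noteq> 0"
    using pair[OF X0(1) H(1), of Y\<^sub>0] H(2) Y0n unfolding K_def[symmetric] Y\<^sub>0_def[symmetric] by simp
  then have "K \<noteq> 0" by (auto simp: hm_linear)
  then have "hm K K \<noteq> 0" by simp
  \<comment> \<open>Taking \<open>H = K\<close> in \<open>pair\<close> shows that
    \<open>hm K K\<close> is a multiple of \<open>cnj (\<alpha> K)\<close>.\<close>
  then have aK: "\<alpha> K \<noteq> 0"
    using pair[OF X0(1) Kh, of Y\<^sub>0] unfolding K_def[symmetric] by auto
  define C where "C = (2 / \<alpha> K) *\<^sub>C K"
  let ?S = "{lie X Y | X Y. X \<in> rs \<alpha> \<and> Y \<in> rs (- \<alpha>)}"
  have "K \<in> ?S" unfolding K_def using X0(1) Y0 by blast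
  then have "C \<in> cx.span ?S" unfolding C_def by (intro cx.span_scale cx.span_base)
  moreover have aC: "\<alpha> C = 2" using aK by (simp add: C_def dual_scale[OF ad Kh])
  moreover have "H = C" if "H \<in> cx.span ?S" "\<alpha> H = 2" for H
  proof -
    have "?S \<subseteq> cx.span {K}"
    proof
      fix Z assume "Z \<in> ?S"
      then obtain c where "Z = c *\<^sub>C K" using multiple by blast
      then show "Z \<in> cx.span {K}" by (simp add: cx.span_scale cx.span_base)
    qed
    then have "cx.span ?S \<subseteq> cx.span {K}" by (rule cx.span_minimal[OF _ cx.subspace_span])
    then have "H \<in> cx.span {K}" using that(1) by (rule subsetD)
    then obtain c where c: "H = c *\<^sub>C K" unfolding cx.span_singleton by blast
    then have "c * \<alpha> K = 2" using that(2) by (simp add: dual_scale[OF ad Kh])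
    then have "c = 2 / \<alpha> K" using aK by (simp add: eq_divide_eq)
    then show ?thesis by (simp add: c C_def)
  qed
  ultimately have C: "H\<^sub>c \<alpha> = C" unfolding coroot_def by (blast intro!: the_equality)
  show "\<alpha> (H\<^sub>c \<alpha>) = 2" by (simp add: C aC)
  show "H\<^sub>c \<alpha> \<in> h" unfolding C C_def by (rule h_closed(3)[OF Kh])
  assume "X \<in> rs \<alpha>" "Y \<in> rs (- \<alpha>)"
  then obtain c where "lie X Y = c *\<^sub>C K" using multiple by blast
  then show "lie X Y = (\<alpha> (lie X Y) / 2) *\<^sub>C H\<^sub>c \<alpha>"
    using aK by (simp add: C C_def dual_scale[OF ad Kh])
qed

end

section \<open>Weyl-Chevalley bases: multiplicity one, signs of coroot values, finiteness\<close>

locale chevalley_data = cartan_data br ip h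
  for br :: "'u::real_vector \<Rightarrow> 'u \<Rightarrow> 'u" and ip and h +
  fixes E :: "('u cx \<Rightarrow> complex) \<Rightarrow> 'u cx"
    and N :: "('u cx \<Rightarrow> complex) \<Rightarrow> ('u cx \<Rightarrow> complex) \<Rightarrow> int"
  assumes weyl_chevalley: "weyl_chevalley_basis br h E N"
begin

lemma E_rs: "\<alpha> \<in> \<Delta> \<Longrightarrow> E \<alpha> \<in> rs \<alpha>"
  and E_bracket: "\<alpha> \<in> \<Delta> \<Longrightarrow> lie (E \<alpha>) (E (- \<alpha>)) = H\<^sub>c \<alpha>"
  and E_conj: "\<alpha> \<in> \<Delta> \<Longrightarrow> cx_conj (E \<alpha>) = - E (- \<alpha>)"
  and coroot_conj: "\<alpha> \<in> \<Delta> \<Longrightarrow> cx_conj (H\<^sub>c \<alpha>) = - H\<^sub>c \<alpha>"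
  and E_lie: "\<alpha> \<in> \<Delta> \<Longrightarrow> \<beta> \<in> \<Delta> \<Longrightarrow> \<alpha> + \<beta> \<in> \<Delta> \<Longrightarrow> lie (E \<alpha>) (E \<beta>) = of_int (N \<alpha> \<beta>) *\<^sub>C E (\<alpha> + \<beta>)"
  and N_minus: "\<alpha> \<in> \<Delta> \<Longrightarrow> \<beta> \<in> \<Delta> \<Longrightarrow> \<alpha> + \<beta> \<in> \<Delta> \<Longrightarrow> N \<alpha> \<beta> = - N (- \<alpha>) (- \<beta>)"
  using weyl_chevalley unfolding weyl_chevalley_basis_def by blast+

text \<open>The series contains n = 0 because \<beta> is a root, so its lower end is at most 0 and
  the absolute value at least 1.\<close>

lemma N_nz:
  assumes "\<alpha> \<in> \<Delta>" "\<beta> \<in> \<Delta>" "\<alpha> + \<beta> \<in> \<Delta>"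
  shows "N \<alpha> \<beta> \<noteq> 0"
proof -
  obtain p\<^sub>0 q\<^sub>0 :: int where
    str: "\<And>n. (\<lambda>X. \<beta> X + of_int n * \<alpha> X) \<in> \<Delta> \<longleftrightarrow> p\<^sub>0 \<le> n \<and> n \<le> q\<^sub>0" and
    "\<bar>N \<alpha> \<beta>\<bar> = 1 - p\<^sub>0"
    using weyl_chevalley assms unfolding weyl_chevalley_basis_def by meson
  moreover have "p\<^sub>0 \<le> 0" using str[of 0] assms(2) by simp
  ultimately show ?thesis by simp
qed

lemma E_nz: "\<alpha> \<in> \<Delta> \<Longrightarrow> E \<alpha> \<noteq> 0"
  using E_bracket[of \<alpha>] coroot_bracket(2)[of \<alpha>] dual_zero[OF root_dual, of \<alpha>]
  by (auto simp: lie_linear)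

lemma lie_E_zero:
  assumes "\<alpha> \<in> \<Delta>" "\<beta> \<in> \<Delta>" "\<alpha> + \<beta> \<notin> \<Delta>" "\<alpha> + \<beta> \<noteq> 0"
  shows "lie (E \<alpha>) (E \<beta>) = 0"
  using rs_lie[OF E_rs[OF assms(1)] E_rs[OF assms(2)]]
    rs_trivial[OF dual_closed(1)[OF root_dual root_dual] assms(3,4)] assms(1,2) by auto

text \<open>If \<open>[E\<^sub>-\<^sub>\<alpha>, X] = 0\<close> then \<open>\<parallel>[E\<^sub>\<alpha>, X]\<parallel>\<^sup>2 = - 2 \<parallel>X\<parallel>\<^sup>2\<close>, so \<open>ad E\<^sub>-\<^sub>\<alpha>\<close> is injective on the root space.\<close>

lemma E_spans:
  assumes a: "\<alpha> \<in> \<Delta>" and X: "X \<in> rs \<alpha>"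
  shows "\<exists>c. X = c *\<^sub>C E \<alpha>"
proof -
  have a': "- \<alpha> \<in> \<Delta>" by (rule root_uminus[OF a])
  \<comment> \<open>The multiple of \<open>E \<alpha>\<close> whose bracket with
    \<open>E (- \<alpha>)\<close> equals that of \<open>X\<close>, so that \<open>Y\<close> commutes
    with \<open>E (- \<alpha>)\<close>.\<close>
  define c where "c = \<alpha> (lie X (E (- \<alpha>))) / 2"
  define Y where "Y = X - c *\<^sub>C E \<alpha>"
  have Y: "Y \<in> rs \<alpha>"
    using X E_rs[OF a] by (simp add: Y_def rs_iff lie_linear cx.scale_right_diff_distrib mult.commute)
  have "lie Y (E (- \<alpha>)) = 0"
    using coroot_bracket(3)[OF a X E_rs[OF a']] by (simp add: Y_def lie_linear E_bracket[OF a] c_def)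
  then have 0: "lie (E (- \<alpha>)) Y = 0" by (metis lie_antisym neg_0_equal_iff_equal)
  have H: "lie (lie (E \<alpha>) (E (- \<alpha>))) Y = 2 *\<^sub>C Y"
    using rsD[OF Y coroot_bracket(1)[OF a]] by (simp add: E_bracket[OF a] coroot_bracket(2)[OF a])
  have "lie (E (- \<alpha>)) (lie (E \<alpha>) Y) = - (2 *\<^sub>C Y)"
    using lie_jacobi[of "E \<alpha>" "E (- \<alpha>)" Y] by (simp add: 0 H lie_linear add_eq_0_iff)
  then have "hm (lie (E \<alpha>) Y) (lie (E \<alpha>) Y) = - 2 * hm Y Y"
    using hm_invariant[of "E \<alpha>" Y "lie (E \<alpha>) Y"] by (simp add: E_conj[OF a] lie_linear hm_linear)
  moreover have "Re (hm Z Z) \<ge> 0" for Z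
    using hm_self(1)[of Z] by (cases "Z = 0") (auto simp: hm_linear)
  then have "Re (hm (lie (E \<alpha>) Y) (lie (E \<alpha>) Y)) \<ge> 0" .
  ultimately have "\<not> Re (hm Y Y) > 0" by simp
  then have "Y = 0" using hm_self(1) by blast
  then show ?thesis by (auto simp: Y_def)
qed

lemma lie_E_E:
  assumes "\<alpha> \<in> \<Delta>" "\<beta> \<in> \<Delta>" "\<alpha> + \<beta> \<notin> \<Delta>" "\<alpha> + \<beta> \<noteq> 0"
  shows "lie (E \<alpha>) (lie (E (- \<alpha>)) (E \<beta>)) = \<beta> (H\<^sub>c \<alpha>) *\<^sub>C E \<beta>"
  using lie_jacobi[of "E \<alpha>" "E (- \<alpha>)" "E \<beta>"] rsD[OF E_rs[OF assms(2)] coroot_bracket(1)[OF assms(1)]]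
  by (simp add: lie_E_zero[OF assms] E_bracket[OF assms(1)] lie_linear)

text \<open>ad E_-alpha has adjoint ad E_alpha, so \<open>lie_E_E\<close> evaluates the norm of
  [E_-alpha, E_beta]. This supplies the signs usually taken from sl2 theory.\<close>

lemma coroot_pos:
  assumes "\<alpha> \<in> \<Delta>" "\<beta> \<in> \<Delta>" "\<alpha> + \<beta> \<notin> \<Delta>" "\<alpha> + \<beta> \<noteq> 0"
  shows "\<beta> (H\<^sub>c \<alpha>) * hm (E \<beta>) (E \<beta>) = hm (lie (E (- \<alpha>)) (E \<beta>)) (lie (E (- \<alpha>)) (E \<beta>))"
  using hm_invariant[of "E \<alpha>" "lie (E (- \<alpha>)) (E \<beta>)" "E \<beta>"] lie_E_E[OF assms]
  by (simp add: E_conj[OF assms(1)] lie_linear hm_linear)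

lemma coroot_nonneg:
  assumes "\<alpha> \<in> \<Delta>" "\<beta> \<in> \<Delta>" "\<alpha> + \<beta> \<notin> \<Delta>" "\<alpha> + \<beta> \<noteq> 0"
  shows "Re (\<beta> (H\<^sub>c \<alpha>)) \<ge> 0"
    and "lie (E (- \<alpha>)) (E \<beta>) \<noteq> 0 \<Longrightarrow> Re (\<beta> (H\<^sub>c \<alpha>)) > 0"
proof -
  let ?Z = "lie (E (- \<alpha>)) (E \<beta>)"
  have e: "Re (\<beta> (H\<^sub>c \<alpha>)) * Re (hm (E \<beta>) (E \<beta>)) = Re (hm ?Z ?Z)"
    using arg_cong[OF coroot_pos[OF assms], of Re] by (simp add: hm_self(2))
  have pos: "Re (hm (E \<beta>) (E \<beta>)) > 0" using hm_self(1) E_nz assms(2) by blast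
  show 1: "?Z \<noteq> 0 \<Longrightarrow> Re (\<beta> (H\<^sub>c \<alpha>)) > 0"
    using e pos hm_self(1)[of ?Z] by (metis zero_less_mult_pos2)
  show "Re (\<beta> (H\<^sub>c \<alpha>)) \<ge> 0"
    using e pos 1 by (cases "?Z = 0") (auto simp: hm_linear)
qed

text \<open>The coordinate along \<open>E \<alpha>\<close> by orthogonal projection, available
  before the root decomposition is.\<close>

definition co :: "('u cx \<Rightarrow> complex) \<Rightarrow> 'u cx \<Rightarrow> complex" where
  "co \<alpha> X = hm X (E \<alpha>) / hm (E \<alpha>) (E \<alpha>)"

lemma co_linear:
  "co \<alpha> (X + Y) = co \<alpha> X + co \<alpha> Y" "co \<alpha> (X - Y) = co \<alpha> X - co \<alpha> Y"
  "co \<alpha> (- X) = - co \<alpha> X" "co \<alpha> (c *\<^sub>C X) = c * co \<alpha> X" "co \<alpha> 0 = 0"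
  by (simp_all add: co_def hm_linear add_divide_distrib diff_divide_distrib)

lemma co_sum: "co \<alpha> (sum f A) = (\<Sum>a\<in>A. co \<alpha> (f a))"
  by (simp add: co_def hm_sum sum_divide_distrib)

lemma co_rs: "\<alpha> \<in> \<Delta> \<Longrightarrow> \<beta> \<in> cx_dual h \<Longrightarrow> X \<in> rs \<beta> \<Longrightarrow> \<alpha> \<noteq> \<beta> \<Longrightarrow> co \<alpha> X = 0"
  using rs_orth[of X \<beta> "E \<alpha>" \<alpha>] E_rs root_dual by (simp add: co_def)

lemma co_h: "\<alpha> \<in> \<Delta> \<Longrightarrow> X \<in> h \<Longrightarrow> co \<alpha> X = 0"
  using co_rs[of \<alpha> 0 X] root_nz dual_closed(3) rs_0 by auto

lemma co_E: "\<alpha> \<in> \<Delta> \<Longrightarrow> \<beta> \<in> \<Delta> \<Longrightarrow> co \<alpha> (E \<beta>) = (if \<alpha> = \<beta> then 1 else 0)"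
  using co_rs[OF _ root_dual E_rs, of \<alpha> \<beta>] E_nz by (auto simp: co_def)

lemma co_lie: "\<alpha> \<in> \<Delta> \<Longrightarrow> H \<in> h \<Longrightarrow> co \<alpha> (lie H X) = \<alpha> H * co \<alpha> X"
  using hm_invariant[of H X "E \<alpha>"] rsD[OF E_rs conj_in_h, of \<alpha> H] root_conj[of \<alpha> H]
  by (simp add: co_def hm_linear)

lemma co_conj_eq_0: "\<alpha> \<in> \<Delta> \<Longrightarrow> co (- \<alpha>) (cx_conj X) = 0 \<longleftrightarrow> co \<alpha> X = 0"
  using hm_conj[of X "E \<alpha>"] E_nz[of \<alpha>] E_nz[OF root_uminus, of \<alpha>]
  by (auto simp: co_def E_conj hm_linear)

lemma E_inj: "inj_on E \<Delta>"
  by (rule inj_onI) (metis co_E zero_neq_one)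

lemma finite_roots: "finite \<Delta>"
proof (rule finite_imageD[OF finite_orthogonal E_inj])
  show "X \<noteq> 0" if "X \<in> E ` \<Delta>" for X using that E_nz by auto
  show "hm X Y = 0" if "X \<in> E ` \<Delta>" "Y \<in> E ` \<Delta>" "X \<noteq> Y" for X Y
    using that rs_orth[OF E_rs E_rs root_dual root_dual] by auto
qed

end

section \<open>Positive roots: no vanishing sums, induction from above\<close>

locale b_plus_data = chevalley_data br ip h E N
  for br :: "'u::real_vector \<Rightarrow> 'u \<Rightarrow> 'u" and ip and h and E and N +
  fixes P :: "('u cx \<Rightarrow> complex) set" and I :: "'u \<Rightarrow> 'u"
  assumes positive: "positive_system \<Delta> P"
    and b_plus_structure: "b_plus_complex_structure br h P I"
begin

lemma P_root: "\<alpha> \<in> P \<Longrightarrow> \<alpha> \<in> \<Delta>"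
  and P_minus_root: "\<alpha> \<in> P \<Longrightarrow> - \<alpha> \<in> \<Delta>"
  and P_add: "\<alpha> \<in> P \<Longrightarrow> \<beta> \<in> P \<Longrightarrow> \<alpha> + \<beta> \<in> \<Delta> \<Longrightarrow> \<alpha> + \<beta> \<in> P"
  using positive by (auto simp: positive_system_def)

lemma P_not_minus: "\<alpha> \<in> P \<Longrightarrow> \<beta> \<in> P \<Longrightarrow> \<alpha> \<noteq> - \<beta>"
  using positive by (auto simp: positive_system_def)

lemma P_add_nz: "\<alpha> \<in> P \<Longrightarrow> \<beta> \<in> P \<Longrightarrow> \<alpha> + \<beta> \<noteq> 0"
  using P_not_minus eq_neg_iff_add_eq_0 by blast

lemma root_cases:
  assumes "\<alpha> \<in> \<Delta>"
  obtains "\<alpha> \<in> P" | \<beta> where "\<beta> \<in> P" "\<alpha> = - \<beta>"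
  using assms positive by (auto simp: positive_system_def)

text \<open>A vanishing sum of positive roots pairs with the coroot of one of its terms \<open>\<alpha>\<close>; some other
  term \<open>\<beta>\<close> is then negative on it, and \<open>\<alpha> + \<beta>\<close> shortens the sum.\<close>

lemma sum_positive_nz: "xs \<noteq> [] \<Longrightarrow> set xs \<subseteq> P \<Longrightarrow> sum_list xs \<noteq> 0"
proof (induction "length xs" arbitrary: xs rule: less_induct)
  case less
  then obtain \<alpha> ys where xs: "xs = \<alpha> # ys" and a: "\<alpha> \<in> P" and ys: "set ys \<subseteq> P"
    by (cases xs) auto
  show ?case
  proof
    assume 0: "sum_list xs = 0"
    let ?r = "\<lambda>\<beta>. Re (\<beta> (H\<^sub>c \<alpha>))"
    have r: "?r (sum_list zs) = (\<Sum>\<beta>\<leftarrow>zs. ?r \<beta>)" for zs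
      by (induction zs) auto
    have "2 + (\<Sum>\<beta>\<leftarrow>ys. ?r \<beta>) = 0"
      using arg_cong[OF 0, of ?r] r[of xs] xs coroot_bracket(2)[OF P_root[OF a]] by simp
    moreover have "(\<Sum>\<beta>\<leftarrow>ys. ?r \<beta>) \<ge> 0" if "\<forall>\<beta>\<in>set ys. ?r \<beta> \<ge> 0"
      using that by (intro sum_list_nonneg) auto
    ultimately obtain \<beta> where b: "\<beta> \<in> set ys" "?r \<beta> < 0" by force
    then have bP: "\<beta> \<in> P" using ys by blast
    have nz: "\<alpha> + \<beta> \<noteq> 0" by (rule P_add_nz[OF a bP])
    have "\<alpha> + \<beta> \<in> \<Delta>"
      using coroot_nonneg(1)[OF P_root[OF a] P_root[OF bP] _ nz] b(2) by force
    then have ab: "\<alpha> + \<beta> \<in> P" by (rule P_add[OF a bP])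
    have rm: "sum_list ys = \<beta> + sum_list (remove1 \<beta> ys)"
      by (rule sum_list_map_remove1[of \<beta> ys "\<lambda>x. x", simplified, OF b(1)])
    have "sum_list ((\<alpha> + \<beta>) # remove1 \<beta> ys) \<noteq> 0"
    proof (rule less.hyps)
      show "length ((\<alpha> + \<beta>) # remove1 \<beta> ys) < length xs"
        using b(1) length_pos_if_in_set[OF b(1)] by (simp add: xs length_remove1)
      show "set ((\<alpha> + \<beta>) # remove1 \<beta> ys) \<subseteq> P"
        using ab ys set_remove1_subset[of \<beta> ys] by auto
    qed simp
    then show False using 0 rm by (simp add: xs add.assoc)
  qed
qed

text \<open>A cycle would exhibit 0 as a nonempty sum of positive roots. The order replaces root
  heights and carries the induction from the highest roots downwards.\<close>

lemma wf_above: "wf {(\<alpha>, \<beta>). \<alpha> \<in> P \<and> \<beta> \<in> P \<and> \<alpha> - \<beta> \<in> P}" (is "wf ?R")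
proof -
  have chain: "\<exists>xs. xs \<noteq> [] \<and> set xs \<subseteq> P \<and> \<alpha> - \<beta> = sum_list xs" if "(\<alpha>, \<beta>) \<in> ?R\<^sup>+" for \<alpha> \<beta>
    using that
  proof induction
    case (base \<beta>)
    then have "[\<alpha> - \<beta>] \<noteq> [] \<and> set [\<alpha> - \<beta>] \<subseteq> P \<and> \<alpha> - \<beta> = sum_list [\<alpha> - \<beta>]" by simp
    then show ?case by blast
  next
    case (step \<beta> \<delta>)
    then obtain xs where "xs \<noteq> []" "set xs \<subseteq> P" "\<alpha> - \<beta> = sum_list xs" by blast
    then have "(\<beta> - \<delta>) # xs \<noteq> [] \<and> set ((\<beta> - \<delta>) # xs) \<subseteq> P \<and> \<alpha> - \<delta> = sum_list ((\<beta> - \<delta>) # xs)"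
      using step(2) by (auto simp: algebra_simps)
    then show ?case by blast
  qed
  have "acyclic ?R"
    unfolding acyclic_def
  proof (intro allI notI)
    fix \<alpha> assume "(\<alpha>, \<alpha>) \<in> ?R\<^sup>+"
    then obtain xs where "xs \<noteq> []" "set xs \<subseteq> P" "\<alpha> - \<alpha> = sum_list xs" using chain by blast
    then show False using sum_positive_nz[of xs] by simp
  qed
  moreover have "finite P" using finite_roots P_root by (meson finite_subset subsetI)
  then have "finite (P \<times> P)" by simp
  then have "finite ?R" by (rule finite_subset[rotated]) auto
  ultimately show ?thesis by (rule finite_acyclic_wf[rotated])
qed

section \<open>The eigenspaces of I and the root decomposition\<close>

abbreviation "I' \<equiv> cx_extend I"

definition mp where "mp = m_plus I"
definition mm where "mm = {X. I' X = (- \<i>) *\<^sub>C X}"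

text \<open>\<open>pp\<close> and \<open>pm\<close> are the projections onto m+ and m- along each
  other; \<open>pm\<close> serves as the quotient map from g to g/m+.\<close>

definition pp where "pp X = (1/2) *\<^sub>C (X - \<i> *\<^sub>C I' X)"
definition pm where "pm X = (1/2) *\<^sub>C (X + \<i> *\<^sub>C I' X)"

lemma I_linear: "linear I" and I_cs: "complex_structure I"
  using b_plus_structure
  by (auto simp: b_plus_complex_structure_def integrable_complex_structure_def complex_structure_def)

lemma II: "I' (I' X) = - X" by (rule complex_structure_cx_extend[OF I_cs])

lemmas I_simps = cx_extend_add[OF I_linear] cx_extend_diff[OF I_linear] cx_extend_minus[OF I_linear]
  cx_extend_zero[OF I_linear] cx_extend_scale[OF I_linear]

lemma mp_iff: "X \<in> mp \<longleftrightarrow> I' X = \<i> *\<^sub>C X" by (simp add: mp_def m_plus_def)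
lemma mm_iff: "X \<in> mm \<longleftrightarrow> I' X = (- \<i>) *\<^sub>C X" by (simp add: mm_def)

lemma pp_mp: "pp X \<in> mp"
  by (simp add: pp_def mp_iff I_simps II cx.scale_right_diff_distrib cx.scale_right_distrib algebra_simps)

lemma pm_mm: "pm X \<in> mm"
  by (simp add: pm_def mm_iff I_simps II cx.scale_right_diff_distrib cx.scale_right_distrib
      cx.scale_minus_left algebra_simps)

lemma half: "(1/2) *\<^sub>C (X + X) = X"
  by (simp add: cx_scale_def prod_eq_iff flip: scaleR_2)

lemma pp_pm: "X = pp X + pm X"
proof -
  have "pp X + pm X = (1/2) *\<^sub>C (X + X)"
    by (simp add: pp_def pm_def flip: cx.scale_right_distrib)
  then show ?thesis by (simp add: half)
qed

lemma pm_linear: "pm (X + Y) = pm X + pm Y" "pm (X - Y) = pm X - pm Y" "pm (- X) = - pm X"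
    "pm (c *\<^sub>C X) = c *\<^sub>C pm X" "pm 0 = 0"
  by (simp_all add: pm_def I_simps cx.scale_right_diff_distrib cx.scale_right_distrib mult.commute algebra_simps)

lemma pm_sum: "pm (sum f A) = (\<Sum>a\<in>A. pm (f a))"
  by (induction A rule: infinite_finite_induct) (simp_all add: pm_linear)

lemma pm_of_mp: "X \<in> mp \<Longrightarrow> pm X = 0"
  by (simp add: pm_def mp_iff cx.scale_minus_left)

lemma pm_of_mm: "X \<in> mm \<Longrightarrow> pm X = X"
  by (simp add: pm_def mm_iff half)

lemma mp_subspace: "cx.subspace mp"
  by (rule cx.subspaceI) (simp_all add: mp_iff I_simps cx.scale_right_distrib mult.commute)

lemma mm_subspace: "cx.subspace mm"
  by (rule cx.subspaceI) (simp_all add: mm_iff I_simps cx.scale_right_distrib mult.commute)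

lemmas mp_closed = cx.subspace_0[OF mp_subspace] cx.subspace_add[OF mp_subspace]
  cx.subspace_scale[OF mp_subspace] cx.subspace_diff[OF mp_subspace] cx.subspace_neg[OF mp_subspace]
  cx.subspace_sum[OF mp_subspace]

lemmas mm_closed = cx.subspace_0[OF mm_subspace] cx.subspace_add[OF mm_subspace]
  cx.subspace_scale[OF mm_subspace] cx.subspace_diff[OF mm_subspace] cx.subspace_neg[OF mm_subspace]
  cx.subspace_sum[OF mm_subspace]

lemma conj_mp: "X \<in> mp \<Longrightarrow> cx_conj X \<in> mm"
  by (simp add: mp_iff mm_iff cx_extend_conj[OF I_linear] cx_conj_scale cx_conj_minus)

lemma conj_mm: "X \<in> mm \<Longrightarrow> cx_conj X \<in> mp"
  by (simp add: mp_iff mm_iff cx_extend_conj[OF I_linear] cx_conj_scale cx_conj_minus)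

lemma mp_lie: "X \<in> mp \<Longrightarrow> Y \<in> mp \<Longrightarrow> lie X Y \<in> mp"
  using b_plus_structure
  by (auto simp: mp_def b_plus_complex_structure_def integrable_complex_structure_def cx_subalgebra_def)

lemma mm_lie:
  assumes "X \<in> mm" "Y \<in> mm"
  shows "lie X Y \<in> mm"
  using conj_mp[OF mp_lie[OF conj_mm[OF assms(1)] conj_mm[OF assms(2)]]] by (simp add: cx_conj_lie)

lemma normalizer_mp: "normalizer br mp = b_plus br h P"
  using b_plus_structure by (simp add: mp_def b_plus_complex_structure_def)

lemma mp_b_plus: "mp \<subseteq> b_plus br h P"
  using mp_lie unfolding normalizer_mp[symmetric] by (auto simp: normalizer_def)

lemma h_mp:
  assumes "H \<in> h" "X \<in> mp"
  shows "lie H X \<in> mp"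
proof -
  have "0 \<in> n_plus br h P" unfolding n_plus_def by (rule cx.span_zero)
  then have "H + 0 \<in> b_plus br h P" using assms(1) unfolding b_plus_def by blast
  then have "H \<in> b_plus br h P" by simp
  then show ?thesis using assms(2) by (auto simp flip: normalizer_mp simp: normalizer_def)
qed

lemma h_mm:
  assumes "H \<in> h" "X \<in> mm"
  shows "lie H X \<in> mm"
  using conj_mp[OF h_mp[OF conj_in_h[OF assms(1)] conj_mm[OF assms(2)]]] by (simp add: cx_conj_lie)

lemma pm_lie_h:
  assumes "H \<in> h"
  shows "pm (lie H X) = lie H (pm X)"
proof -
  have "lie H X = lie H (pp X) + lie H (pm X)"
    using pp_pm[of X] by (metis lie_linear(2))
  then show ?thesis
    by (simp add: pm_linear pm_of_mp[OF h_mp[OF assms pp_mp]] pm_of_mm[OF h_mm[OF assms pm_mm]])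
qed

text \<open>A subalgebra lies in its normalizer, so m+ lies in b+, where only 0 and positive roots
  occur as weights.\<close>

lemma co_mp:
  assumes "X \<in> mp" "\<alpha> \<in> P"
  shows "co (- \<alpha>) X = 0"
proof -
  obtain H Y where X: "X = H + Y" and H: "H \<in> h" and Y: "Y \<in> n_plus br h P"
    using mp_b_plus assms(1) by (auto simp: b_plus_def)
  let ?S = "{Z. co (- \<alpha>) Z = 0}"
  have "cx.subspace ?S" by (rule cx.subspaceI) (simp_all add: co_linear)
  moreover have "Z \<in> ?S" if b: "\<beta> \<in> P" and Z: "Z \<in> rs \<beta>" for Z \<beta>
    using co_rs[OF P_minus_root[OF assms(2)] root_dual[OF P_root[OF b]] Z] P_not_minus[OF b assms(2)]
    by auto
  ultimately have "Y \<in> ?S"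
    using Y cx.span_minimal[of "\<Union>\<alpha>\<in>P. rs \<alpha>" ?S] unfolding n_plus_def by blast
  then show ?thesis using co_h[OF P_minus_root[OF assms(2)] H] by (simp add: X co_linear)
qed

lemma co_mm: "X \<in> mm \<Longrightarrow> \<alpha> \<in> P \<Longrightarrow> co \<alpha> X = 0"
  using co_mp[OF conj_mm, of X \<alpha>] co_conj_eq_0[OF P_root, of \<alpha> X] by simp

text \<open>The root decomposition without simultaneous diagonalization: every vector is
  \<open>pp X + pm X\<close>, m+ lies in b+, and m- is the conjugate of m+. Phrased with a subspace
  it doubles as an induction principle.\<close>

lemma generation:
  assumes S: "cx.subspace S" and hS: "h \<subseteq> S" and ES: "\<And>\<alpha>. \<alpha> \<in> \<Delta> \<Longrightarrow> E \<alpha> \<in> S"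
  shows "X \<in> S"
proof -
  note cl = cx.subspace_add[OF S] cx.subspace_scale[OF S]
  have rsS: "Z \<in> S" if "\<alpha> \<in> \<Delta>" "Z \<in> rs \<alpha>" for Z \<alpha>
    using E_spans[OF that] cl(2)[OF ES[OF that(1)]] by auto
  have np: "n_plus br h P \<subseteq> S"
    unfolding n_plus_def using rsS P_root by (intro cx.span_minimal[OF _ S]) blast
  have "n_plus br h P \<subseteq> {Y. cx_conj Y \<in> S}"
    unfolding n_plus_def
  proof (rule cx.span_minimal)
    show "(\<Union>\<alpha>\<in>P. rs \<alpha>) \<subseteq> {Y. cx_conj Y \<in> S}"
      using rsS rs_conj P_minus_root by blast
    show "cx.subspace {Y. cx_conj Y \<in> S}"
      using cx.subspace_0[OF S] cl by (intro cx.subspaceI) (auto simp: cx_conj_add cx_conj_scale)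
  qed
  moreover have "cx_conj H \<in> S" if "H \<in> h" for H using that conj_in_h hS by blast
  moreover have dec: "\<exists>H Z. Y = H + Z \<and> H \<in> h \<and> Z \<in> n_plus br h P" if "Y \<in> mp" for Y
    using that mp_b_plus unfolding b_plus_def by blast
  ultimately have conj: "cx_conj Y \<in> S" if "Y \<in> mp" for Y
    using that cl(1) by (metis (mono_tags, lifting) cx_conj_add mem_Collect_eq subsetD)
  have "pp X \<in> S" using dec[OF pp_mp[of X]] hS np cl(1) by (metis subsetD)
  moreover have "pm X \<in> S" using conj[OF conj_mm[OF pm_mm[of X]]] by simp
  ultimately show ?thesis using pp_pm[of X] cl(1) by metis
qed

lemma decomposition: "X - (\<Sum>\<alpha>\<in>\<Delta>. co \<alpha> X *\<^sub>C E \<alpha>) \<in> h" (is "?p X \<in> h")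
proof -
  have "X \<in> {X. ?p X \<in> h}"
  proof (rule generation)
    have add: "?p (X + Y) = ?p X + ?p Y" and sc: "?p (c *\<^sub>C X) = c *\<^sub>C ?p X" for X Y c
      by (simp_all add: co_linear cx.scale_left_distrib sum.distrib cx.scale_right_diff_distrib
          cx.scale_sum_right)
    have "?p 0 = 0" by (simp add: co_linear)
    then show "cx.subspace {X. ?p X \<in> h}"
      by (intro cx.subspaceI) (simp_all only: mem_Collect_eq add sc h_closed)
    show "h \<subseteq> {X. ?p X \<in> h}" by (auto simp: co_h)
    show "E \<alpha> \<in> {X. ?p X \<in> h}" if a: "\<alpha> \<in> \<Delta>" for \<alpha>
    proof -
      have "(\<Sum>\<beta>\<in>\<Delta>. co \<beta> (E \<alpha>) *\<^sub>C E \<beta>) = (\<Sum>\<beta>\<in>\<Delta>. if \<beta> = \<alpha> then E \<alpha> else 0)"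
        using a by (intro sum.cong) (auto simp: co_E)
      then show ?thesis using a finite_roots by (simp add: h_closed)
    qed
  qed
  then show ?thesis by simp
qed

lemma mem_h: "(\<And>\<alpha>. \<alpha> \<in> \<Delta> \<Longrightarrow> co \<alpha> X = 0) \<Longrightarrow> X \<in> h"
  using decomposition[of X] by simp

text \<open>The splitting \<open>\<gg> = \<mm>\<^sup>+ \<oplus> \<mm>\<^sup>-\<close> is stable under \<open>ad h\<close>, so both parts of a
  weight vector are weight vectors of the same weight.\<close>

lemma weight_parts:
  assumes "X \<in> rs \<alpha>"
  shows "pp X \<in> rs \<alpha>" "pm X \<in> rs \<alpha>"
proof -
  show m: "pm X \<in> rs \<alpha>"
    using rsD[OF assms] by (auto simp: rs_iff pm_linear simp flip: pm_lie_h)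
  have "pp X = X - pm X" using pp_pm[of X] by (metis add_diff_cancel_right')
  then show "pp X \<in> rs \<alpha>"
    using m assms by (simp add: rs_iff lie_linear cx.scale_right_diff_distrib)
qed

lemma pm_h: "X \<in> h \<Longrightarrow> pm X \<in> h" and pp_h: "X \<in> h \<Longrightarrow> pp X \<in> h"
  using weight_parts[of X 0] rs_0 by auto

text \<open>The m- part of \<open>E \<alpha>\<close> is a multiple of \<open>E \<alpha>\<close>, but
  m- has no component along a positive root.\<close>

lemma E_mp:
  assumes "\<alpha> \<in> P"
  shows "E \<alpha> \<in> mp"
proof -
  have a: "\<alpha> \<in> \<Delta>" by (rule P_root[OF assms])
  obtain c where c: "pm (E \<alpha>) = c *\<^sub>C E \<alpha>"
    using E_spans[OF a weight_parts(2)[OF E_rs[OF a]]] by blast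
  have "co \<alpha> (pm (E \<alpha>)) = c" using a by (simp add: c co_linear co_E)
  then have "pm (E \<alpha>) = 0" using co_mm[OF pm_mm assms, of "E \<alpha>"] c by simp
  then show ?thesis using pp_pm[of "E \<alpha>"] pp_mp[of "E \<alpha>"] by simp
qed

lemma E_mm: "\<alpha> \<in> P \<Longrightarrow> E (- \<alpha>) \<in> mm"
  using conj_mp[OF E_mp, of \<alpha>] mm_closed(5) by (fastforce simp: E_conj P_root)

text \<open>Since \<open>h = h\<^sup>+ \<oplus> \<tau> h\<^sup>+\<close>, a weight is determined by its restriction to \<open>h\<^sup>+\<close>.\<close>

lemma separating_mp:
  assumes d: "\<alpha> \<in> cx_dual h" and c: "\<And>H. H \<in> h \<Longrightarrow> \<alpha> (cx_conj H) = - cnj (\<alpha> H)" and nz: "\<alpha> \<noteq> 0"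
  obtains H where "H \<in> h" "H \<in> mp" "\<alpha> H \<noteq> 0"
proof -
  obtain K where K: "K \<in> h" "\<alpha> K \<noteq> 0" using dual_ext[OF d dual_closed(3)] nz by auto
  have "\<alpha> K = \<alpha> (pp K) + \<alpha> (pm K)"
    using pp_pm[of K] dual_add[OF d pp_h pm_h, of K K] K by simp
  moreover have "\<alpha> (pm K) = - cnj (\<alpha> (cx_conj (pm K)))"
    using c[OF pm_h, of K] K by simp
  ultimately have "\<alpha> (pp K) \<noteq> 0 \<or> \<alpha> (cx_conj (pm K)) \<noteq> 0" using K by auto
  then show ?thesis using that pp_h pm_h pp_mp pm_mm conj_mm conj_in_h K by meson
qed

lemma separating_root:
  assumes "\<alpha> \<in> \<Delta>"
  obtains H where "H \<in> h" "H \<in> mp" "\<alpha> H \<noteq> 0"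
  using separating_mp[of \<alpha>] root_dual root_conj root_nz assms by blast

end

section \<open>Torus automorphisms\<close>

lemma cnj_exp: "cnj (exp z) = exp (cnj z)"
  by (simp add: exp_eq_polar cis_cnj)

context b_plus_data
begin

text \<open>This is exp(ad T) for \<open>T\<close> in \<open>h\<close>: the identity on
  \<open>h\<close> and the factor \<open>exp (\<alpha> T)\<close> on the root space of
  \<open>\<alpha>\<close>.\<close>

definition tor :: "'u cx \<Rightarrow> 'u cx \<Rightarrow> 'u cx" where
  "tor T X = X + (\<Sum>\<alpha>\<in>\<Delta>. ((exp (\<alpha> T) - 1) * co \<alpha> X) *\<^sub>C E \<alpha>)"

lemma tor_add: "tor T (X + Y) = tor T X + tor T Y"
  by (simp add: tor_def co_linear distrib_left cx.scale_left_distrib sum.distrib)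

lemma tor_scale: "tor T (c *\<^sub>C X) = c *\<^sub>C tor T X"
  by (simp add: tor_def co_linear cx.scale_right_distrib cx.scale_sum_right mult.left_commute)

lemma tor_zero: "tor T 0 = 0"
  by (simp add: tor_def co_linear)

lemma tor_h: "X \<in> h \<Longrightarrow> tor T X = X"
  by (simp add: tor_def co_h)

lemma tor_E:
  assumes "\<alpha> \<in> \<Delta>"
  shows "tor T (E \<alpha>) = exp (\<alpha> T) *\<^sub>C E \<alpha>"
proof -
  have "(\<Sum>\<beta>\<in>\<Delta>. ((exp (\<beta> T) - 1) * co \<beta> (E \<alpha>)) *\<^sub>C E \<beta>) =
      (\<Sum>\<beta>\<in>\<Delta>. if \<beta> = \<alpha> then (exp (\<alpha> T) - 1) *\<^sub>C E \<alpha> else 0)"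
    using assms by (intro sum.cong) (auto simp: co_E)
  then show ?thesis using assms finite_roots by (simp add: tor_def cx.scale_left_diff_distrib)
qed

lemma tor_rs:
  assumes "\<alpha> \<in> cx_dual h" "X \<in> rs \<alpha>"
  shows "tor T X = exp (\<alpha> T) *\<^sub>C X"
proof -
  consider "\<alpha> \<in> \<Delta>" | "\<alpha> = 0" | "X = 0" using rs_trivial[OF assms(1)] assms(2) by blast
  then show ?thesis
  proof cases
    case 1
    then obtain c where "X = c *\<^sub>C E \<alpha>" using E_spans assms(2) by blast
    then show ?thesis by (simp add: tor_scale tor_E[OF 1] mult.commute)
  next
    case 2
    then show ?thesis using assms(2) tor_h rs_0 by simp
  qed (simp add: tor_zero)
qed

lemma weight_induct [case_names zero add scale weight]:
  assumes "Q 0" "\<And>X Y. Q X \<Longrightarrow> Q Y \<Longrightarrow> Q (X + Y)" "\<And>c X. Q X \<Longrightarrow> Q (c *\<^sub>C X)"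
    and weight: "\<And>\<alpha> X. \<alpha> \<in> insert 0 \<Delta> \<Longrightarrow> X \<in> rs \<alpha> \<Longrightarrow> Q X"
  shows "Q X"
proof -
  have "X \<in> {X. Q X}"
  proof (rule generation)
    show "cx.subspace {X. Q X}" using assms(1-3) by (intro cx.subspaceI) simp_all
    show "h \<subseteq> {X. Q X}" using weight[of 0] rs_0 by blast
    show "E \<alpha> \<in> {X. Q X}" if "\<alpha> \<in> \<Delta>" for \<alpha> using weight E_rs that by blast
  qed
  then show ?thesis by simp
qed

lemma weight_dual: "\<alpha> \<in> insert 0 \<Delta> \<Longrightarrow> \<alpha> \<in> cx_dual h"
  using dual_closed(3) root_dual by blast

text \<open>Weights add under the bracket and exp turns sums into products. A sum of two weights may
  fail to be a weight; the bracket is then 0, a case that \<open>tor_rs\<close> covers.\<close>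

lemma tor_lie:
  assumes T: "T \<in> h"
  shows "tor T (lie X Y) = lie (tor T X) (tor T Y)"
proof -
  have 1: "tor T (lie X Y) = lie (tor T X) (tor T Y)"
    if "\<alpha> \<in> insert 0 \<Delta>" "X \<in> rs \<alpha>" "\<beta> \<in> insert 0 \<Delta>" "Y \<in> rs \<beta>" for X Y \<alpha> \<beta>
    using tor_rs[OF weight_dual[OF that(1)] that(2)] tor_rs[OF weight_dual[OF that(3)] that(4)]
      tor_rs[OF dual_closed(1)[OF weight_dual[OF that(1)] weight_dual[OF that(3)]] rs_lie[OF that(2,4)]]
    by (simp add: lie_linear exp_add mult.commute)
  have 2: "tor T (lie X Y) = lie (tor T X) (tor T Y)" if "\<alpha> \<in> insert 0 \<Delta>" "X \<in> rs \<alpha>" for X Y \<alpha>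
    by (induction Y rule: weight_induct)
       (use 1[OF that] in \<open>simp_all add: tor_add tor_scale tor_zero lie_linear\<close>)
  show ?thesis
    by (induction X rule: weight_induct)
       (use 2 in \<open>simp_all add: tor_add tor_scale tor_zero lie_linear\<close>)
qed

text \<open>Roots are imaginary on a real \<open>T\<close>, so the factors on the root spaces of
  \<open>\<alpha>\<close> and \<open>- \<alpha>\<close> are conjugate.\<close>

lemma tor_conj:
  assumes T: "T \<in> h" "cx_conj T = T"
  shows "tor T (cx_conj X) = cx_conj (tor T X)"
proof -
  have 1: "tor T (cx_conj X) = cx_conj (tor T X)" if a: "\<alpha> \<in> insert 0 \<Delta>" and X: "X \<in> rs \<alpha>" for X \<alpha>
  proof -
    have "\<alpha> T = - cnj (\<alpha> T)" using root_conj[of \<alpha> T] a T by auto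
    then have "cnj (\<alpha> T) = (- \<alpha>) T" by (metis minus_minus uminus_apply)
    then show ?thesis
      using tor_rs[OF weight_dual[OF a] X, of T]
        tor_rs[OF dual_closed(2)[OF weight_dual[OF a]] rs_conj[OF X], of T]
      by (simp add: cx_conj_scale cnj_exp)
  qed
  show ?thesis
    by (induction X rule: weight_induct)
       (use 1 in \<open>simp_all add: tor_add tor_scale tor_zero cx_conj_add cx_conj_scale\<close>)
qed

lemma tor_minus:
  assumes T: "T \<in> h"
  shows "tor T (tor (- T) X) = X" "tor (- T) (tor T X) = X"
proof -
  have 1: "tor T (tor (- T) X) = X \<and> tor (- T) (tor T X) = X"
    if a: "\<alpha> \<in> insert 0 \<Delta>" and X: "X \<in> rs \<alpha>" for X \<alpha>
  proof -
    have "exp (\<alpha> T) * exp (\<alpha> (- T)) = 1"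
      by (simp add: dual_minus[OF weight_dual[OF a] T] exp_minus)
    then show ?thesis
      by (simp add: tor_rs[OF weight_dual[OF a] X] tor_scale mult.commute)
  qed
  have "tor T (tor (- T) X) = X \<and> tor (- T) (tor T X) = X"
    by (induction X rule: weight_induct) (use 1 in \<open>simp_all add: tor_add tor_scale tor_zero\<close>)
  then show "tor T (tor (- T) X) = X" "tor (- T) (tor T X) = X" by simp_all
qed

lemma I_h: "X \<in> h \<Longrightarrow> I' X \<in> h"
proof -
  assume X: "X \<in> h"
  have "I' X = I' (pp X) + I' (pm X)"
    using pp_pm[of X] cx_extend_add[OF I_linear] by metis
  also have "\<dots> = \<i> *\<^sub>C pp X + (- \<i>) *\<^sub>C pm X"
    using pp_mp[of X] pm_mm[of X] by (simp add: mp_iff mm_iff)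
  also have "\<dots> \<in> h" using pp_h[OF X] pm_h[OF X] by (intro h_closed)
  finally show ?thesis .
qed

text \<open>\<open>I\<close> acts by a scalar on each root line and preserves \<open>h\<close>,
  where \<open>tor T\<close> is the identity.\<close>

lemma tor_I: "tor T (I' X) = I' (tor T X)"
proof -
  have "X \<in> {X. tor T (I' X) = I' (tor T X)}"
  proof (rule generation)
    show "E \<alpha> \<in> {X. tor T (I' X) = I' (tor T X)}" if a: "\<alpha> \<in> \<Delta>" for \<alpha>
    proof -
      have "\<exists>c. I' (E \<alpha>) = c *\<^sub>C E \<alpha>"
        using a E_mp E_mm unfolding mp_iff mm_iff by (cases rule: root_cases) blast+
      then show ?thesis using tor_E[OF a, of T] by (auto simp: tor_scale I_simps mult.commute)
    qed
    show "cx.subspace {X. tor T (I' X) = I' (tor T X)}"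
      by (intro cx.subspaceI) (simp_all add: tor_add tor_scale tor_zero I_simps)
    show "h \<subseteq> {X. tor T (I' X) = I' (tor T X)}" by (auto simp: tor_h I_h)
  qed
  then show ?thesis by simp
qed

text \<open>The restriction of \<open>tor T\<close> to the real form; for \<open>T\<close> fixed by
  \<open>cx_conj\<close> the dropped second component is 0.\<close>

definition tr :: "'u cx \<Rightarrow> 'u \<Rightarrow> 'u" where "tr T x = fst (tor T (x, 0))"

lemma tr_tor:
  assumes T: "T \<in> h" "cx_conj T = T"
  shows "linear (tr T)" "cx_extend (tr T) = tor T"
proof -
  have fixed: "tor T (x, 0) = (tr T x, 0)" for x
  proof -
    have "cx_conj (tor T (x, 0)) = tor T (x, 0)"
      using tor_conj[OF T, of "(x, 0)"] by (simp add: cx_conj_def)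
    then have "snd (tor T (x, 0)) = - snd (tor T (x, 0))" by (simp add: cx_conj_def prod_eq_iff)
    then have "2 *\<^sub>R snd (tor T (x, 0)) = 0" by (metis add.right_inverse scaleR_2)
    then show ?thesis by (simp add: tr_def prod_eq_iff)
  qed
  show "linear (tr T)"
  proof (rule linearI)
    show "tr T (x + y) = tr T x + tr T y" for x y
      using tor_add[of T "(x, 0)" "(y, 0)"] by (simp add: fixed)
    show "tr T (r *\<^sub>R x) = r *\<^sub>R tr T x" for r x
      using tor_scale[of T "complex_of_real r" "(x, 0)"] by (simp add: fixed cx_scale_def)
  qed
  show "cx_extend (tr T) = tor T"
  proof
    fix X :: "'u cx"
    have "tor T X = tor T ((fst X, 0) + \<i> *\<^sub>C (snd X, 0))" by (simp add: cx_scale_def)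
    also have "\<dots> = cx_extend (tr T) X"
      by (simp add: tor_add tor_scale fixed) (simp add: cx_extend_def cx_scale_def)
    finally show "cx_extend (tr T) X = tor T X" ..
  qed
qed

lemma cx_extend_inj: "cx_extend f = cx_extend g \<Longrightarrow> f = g"
proof
  fix x assume "cx_extend f = cx_extend g"
  then have "cx_extend f (x, x) = cx_extend g (x, x)" by simp
  then show "f x = g x" by (simp add: cx_extend_def)
qed

lemma tr_automorphism:
  assumes T: "T \<in> h" "cx_conj T = T"
  shows "tr T \<circ> tr (- T) = id" "tr (- T) \<circ> tr T = id" "lie_automorphism br (tr T)"
    "tr T \<circ> I = I \<circ> tr T"
proof -
  have T': "- T \<in> h" "cx_conj (- T) = - T" using T h_closed by (auto simp: cx_conj_minus)
  note t = tr_tor[OF T] and t' = tr_tor[OF T']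
  show inv: "tr T \<circ> tr (- T) = id" "tr (- T) \<circ> tr T = id"
    by (rule cx_extend_inj, rule ext,
        simp only: cx_extend_comp t t' tor_minus[OF T(1)], simp add: cx_extend_def)+
  have "tr T (br x y) = br (tr T x) (tr T y)" for x y
  proof -
    have "cx_extend (tr T) (lie (x, 0) (y, 0)) = lie (cx_extend (tr T) (x, 0)) (cx_extend (tr T) (y, 0))"
      by (simp add: t tor_lie[OF T(1)])
    then show ?thesis by (simp add: cx_extend_def cx_bracket_def br_linear linear_0[OF t(1)])
  qed
  then show "lie_automorphism br (tr T)"
    using t(1) o_bij[OF inv(2,1)] by (simp add: lie_automorphism_def)
  show "tr T \<circ> I = I \<circ> tr T"
    by (rule cx_extend_inj, rule ext, simp add: cx_extend_comp t tor_I)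
qed

end

section \<open>The cocycle of a matching complex structure\<close>

locale hyper_data = b_plus_data br ip h E N P I
  for br :: "'u::real_vector \<Rightarrow> 'u \<Rightarrow> 'u" and ip and h and E and N and P and I +
  fixes J :: "'u \<Rightarrow> 'u"
  assumes J_integrable: "integrable_complex_structure br J"
    and J_anti: "I (J x) = - J (I x)"
begin

abbreviation "J' \<equiv> cx_extend J"

lemma J_cs: "complex_structure J" and J_linear: "linear J"
  using J_integrable by (auto simp: integrable_complex_structure_def complex_structure_def)

lemmas J_simps = cx_extend_add[OF J_linear] cx_extend_diff[OF J_linear] cx_extend_minus[OF J_linear]
  cx_extend_zero[OF J_linear] cx_extend_scale[OF J_linear]

lemma JJ: "J' (J' X) = - X" by (rule complex_structure_cx_extend[OF J_cs])

lemma IJ: "I' (J' X) = - J' (I' X)" by (simp add: cx_extend_def J_anti)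

lemma J_mp: "X \<in> mp \<Longrightarrow> J' X \<in> mm"
  by (simp add: mp_iff mm_iff IJ J_simps cx.scale_minus_left)

lemma J_mm: "X \<in> mm \<Longrightarrow> J' X \<in> mp"
  by (simp add: mp_iff mm_iff IJ J_simps cx.scale_minus_left)

text \<open>Modulo \<open>\<mm>\<^sup>+\<close>, the map \<open>J\<close> is a derivation from \<open>\<mm>\<^sup>+\<close> to the module \<open>\<gg> / \<mm>\<^sup>+ \<cong> \<mm>\<^sup>-\<close>.\<close>

lemma cocycle:
  assumes "X \<in> mp" "Y \<in> mp"
  shows "J' (lie X Y) = pm (lie X (J' Y) + lie (J' X) Y)"
proof -
  have "pm (J' (lie X Y - lie (J' X) (J' Y))) = pm (lie X (J' Y) + lie (J' X) Y)"
    by (simp only: integrable_cx[OF J_integrable])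
  moreover have "pm (J' (lie X Y)) = J' (lie X Y)"
    by (rule pm_of_mm[OF J_mp[OF mp_lie[OF assms]]])
  moreover have "pm (J' (lie (J' X) (J' Y))) = 0"
    by (rule pm_of_mp[OF J_mm[OF mm_lie[OF J_mp J_mp]]]) (use assms in auto)
  ultimately show ?thesis by (simp add: J_simps pm_linear)
qed

text \<open>Let c(X) be the coordinate of J X along E_-alpha. For the commuting elements X, Y of h+
  the cocycle identity reads \<alpha>(X) c(Y) = \<alpha>(Y) c(X), so c is proportional to \<alpha>,
  which is nonzero on h+.\<close>

lemma cocycle_h:
  assumes a: "\<alpha> \<in> P"
  shows "\<exists>w. \<forall>X\<in>h \<inter> mp. co (- \<alpha>) (J' X) = w * \<alpha> X"
proof -
  have comm: "\<alpha> X * co (- \<alpha>) (J' Y) = \<alpha> Y * co (- \<alpha>) (J' X)"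
    if X: "X \<in> h" "X \<in> mp" and Y: "Y \<in> h" "Y \<in> mp" for X Y
  proof -
    have "0 = J' (lie X Y)" using h_abelian[OF X(1) Y(1)] by (simp add: J_simps)
    also have "\<dots> = pm (lie X (J' Y)) - pm (lie Y (J' X))"
      using cocycle[OF X(2) Y(2)] lie_antisym[of "J' X" Y] by (simp add: pm_linear)
    also have "\<dots> = lie X (J' Y) - lie Y (J' X)"
      using X Y by (simp add: pm_of_mm h_mm J_mp)
    finally have "co (- \<alpha>) (lie X (J' Y)) = co (- \<alpha>) (lie Y (J' X))" by simp
    then show ?thesis using co_lie[OF P_minus_root[OF a]] X Y by simp
  qed
  obtain K where K: "K \<in> h" "K \<in> mp" "\<alpha> K \<noteq> 0"
    using separating_root[OF P_root[OF a]] by blast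
  show ?thesis
  proof (intro exI ballI)
    fix X assume "X \<in> h \<inter> mp"
    then show "co (- \<alpha>) (J' X) = (co (- \<alpha>) (J' K) / \<alpha> K) * \<alpha> X"
      using comm[of K X] K by (simp add: field_simps)
  qed
qed

text \<open>The choice is unique for positive \<open>\<alpha>\<close>, which does not vanish on
  \<open>h \<inter> mp\<close>.\<close>

definition v :: "('u cx \<Rightarrow> complex) \<Rightarrow> complex" where
  "v \<alpha> = (SOME w. \<forall>X\<in>h \<inter> mp. co (- \<alpha>) (J' X) = w * \<alpha> X)"

lemma v: "\<alpha> \<in> P \<Longrightarrow> X \<in> h \<Longrightarrow> X \<in> mp \<Longrightarrow> co (- \<alpha>) (J' X) = v \<alpha> * \<alpha> X"
  using someI_ex[OF cocycle_h, of \<alpha>] unfolding v_def by blast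

text \<open>As [E_-alpha, X] = \<alpha>(X) E_-alpha, the vectors J X and [V, X] have equal
  coordinates along all negative root vectors for X in h+.\<close>

definition V :: "'u cx" where "V = (\<Sum>\<alpha>\<in>P. v \<alpha> *\<^sub>C E (- \<alpha>))"

lemma finite_P: "finite P"
  using finite_roots P_root by (meson finite_subset subsetI)

lemma V_mm: "V \<in> mm"
  unfolding V_def by (intro mm_closed E_mm)

lemma co_V: "\<alpha> \<in> P \<Longrightarrow> co (- \<alpha>) V = v \<alpha>"
proof -
  assume a: "\<alpha> \<in> P"
  have "co (- \<alpha>) V = (\<Sum>\<beta>\<in>P. if \<beta> = \<alpha> then v \<alpha> else 0)"
    unfolding V_def co_sum using a by (intro sum.cong) (auto simp: co_linear co_E P_minus_root)
  then show ?thesis using a finite_P by simp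
qed

lemma J_h_part:
  assumes X: "X \<in> h" "X \<in> mp"
  shows "J' X - lie V X \<in> h"
proof (rule mem_h)
  fix \<alpha> assume a: "\<alpha> \<in> \<Delta>"
  have c: "co \<alpha> (lie V X) = - (\<alpha> X * co \<alpha> V)"
    using co_lie[OF a X(1), of V] lie_antisym[of V X] by (simp add: co_linear)
  from a show "co \<alpha> (J' X - lie V X) = 0"
  proof (cases rule: root_cases)
    case 1
    then show ?thesis using co_mm[OF J_mp[OF X(2)]] co_mm[OF V_mm] by (simp add: co_linear c)
  next
    case (2 \<beta>)
    then show ?thesis using v[OF _ X, of \<beta>] co_V[of \<beta>] c by (simp add: co_linear)
  qed
qed

text \<open>The difference of both sides lies in m- and has weight \<beta> under h+. Only 0 and
  negatives of positive roots are weights of m-, and none of them agrees with \<beta> on h+.\<close>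

lemma J_E:
  assumes b: "\<beta> \<in> P"
  shows "J' (E \<beta>) = pm (lie V (E \<beta>))"
proof -
  define Q where "Q = pm (lie V (E \<beta>))"
  define Y where "Y = J' (E \<beta>) - Q"
  have Ymm: "Y \<in> mm" unfolding Y_def Q_def by (intro mm_closed J_mp E_mp b pm_mm)
  have weight: "lie H Y = \<beta> H *\<^sub>C Y" if H: "H \<in> h" "H \<in> mp" for H
  proof -
    have HE: "lie H (E \<beta>) = \<beta> H *\<^sub>C E \<beta>" by (rule rsD[OF E_rs[OF P_root[OF b]] H(1)])
    \<comment> \<open>This discrepancy lies in \<open>h\<close>, so it maps \<open>E \<beta>\<close>
      into m+ and is invisible to \<open>pm\<close>.\<close>
    let ?D = "J' H - lie V H"
    have "lie ?D (E \<beta>) = \<beta> ?D *\<^sub>C E \<beta>" by (rule rsD[OF E_rs[OF P_root[OF b]] J_h_part[OF H]])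
    then have "lie ?D (E \<beta>) \<in> mp" using mp_closed(3)[OF E_mp[OF b]] by simp
    then have "pm (lie ?D (E \<beta>)) = 0" by (rule pm_of_mp)
    then have 1: "pm (lie (J' H) (E \<beta>)) = pm (lie (lie V H) (E \<beta>))"
      by (simp add: lie_linear pm_linear)
    have "lie (lie V H) (E \<beta>) = \<beta> H *\<^sub>C lie V (E \<beta>) - lie H (lie V (E \<beta>))"
      using lie_jacobi[of V H "E \<beta>"] by (simp add: HE lie_linear)
    then have 2: "pm (lie (lie V H) (E \<beta>)) = \<beta> H *\<^sub>C Q - lie H Q"
      by (simp add: pm_linear Q_def pm_lie_h[OF H(1)])
    have "\<beta> H *\<^sub>C J' (E \<beta>) = J' (lie H (E \<beta>))" by (simp add: HE J_simps)
    also have "\<dots> = pm (lie H (J' (E \<beta>))) + pm (lie (J' H) (E \<beta>))"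
      by (simp add: cocycle[OF H(2) E_mp[OF b]] pm_linear)
    also have "pm (lie H (J' (E \<beta>))) = lie H (J' (E \<beta>))"
      by (intro pm_of_mm h_mm H J_mp E_mp b)
    finally show ?thesis
      by (simp add: Y_def 1 2 lie_linear cx.scale_right_diff_distrib)
  qed
  have "co (- \<alpha>) Y = 0" if a: "\<alpha> \<in> P" for \<alpha>
  proof -
    have "(\<alpha> + \<beta>) (cx_conj H) = - cnj ((\<alpha> + \<beta>) H)" if "H \<in> h" for H
      using root_conj[OF P_root[OF a] that] root_conj[OF P_root[OF b] that] by simp
    then obtain H where H: "H \<in> h" "H \<in> mp" "(\<alpha> + \<beta>) H \<noteq> 0"
      using separating_mp[OF dual_closed(1)[OF root_dual root_dual] _ P_add_nz[OF a b]] a b P_root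
      by metis
    have "(- \<alpha>) H * co (- \<alpha>) Y = \<beta> H * co (- \<alpha>) Y"
      using co_lie[OF P_minus_root[OF a] H(1), of Y] by (simp add: weight[OF H(1,2)] co_linear)
    then have "(\<alpha> + \<beta>) H * co (- \<alpha>) Y = 0" by (simp add: algebra_simps add_eq_0_iff)
    then show ?thesis using H(3) by simp
  qed
  then have "Y \<in> h"
    using co_mm[OF Ymm] by (intro mem_h) (auto elim: root_cases)
  moreover obtain H where H: "H \<in> h" "H \<in> mp" "\<beta> H \<noteq> 0"
    using separating_root[OF P_root[OF b]] by blast
  ultimately have "\<beta> H *\<^sub>C Y = 0" using weight[OF H(1,2)] h_abelian by simp
  then have "Y = 0" using H(3) by simp
  then show ?thesis by (simp add: Y_def Q_def)
qed

end

section \<open>The stem\<close>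

locale stem_data = hyper_data br ip h E N P I J
  for br :: "'u::real_vector \<Rightarrow> 'u \<Rightarrow> 'u" and ip and h and E and N and P and I and J +
  fixes \<Gamma> :: "('u cx \<Rightarrow> complex) set"
  assumes stem: "is_stem P \<Gamma>"
begin

lemma stem_union: "P = \<Gamma> \<union> (\<Union>\<gamma>\<in>\<Gamma>. Phi P \<gamma>)"
  using stem unfolding is_stem_def by (rule conjunct1)

lemma stem_P: "\<gamma> \<in> \<Gamma> \<Longrightarrow> \<gamma> \<in> P"
  by (subst stem_union) (rule UnI1)

lemma Phi_iff: "\<alpha> \<in> Phi P \<gamma> \<longleftrightarrow> \<alpha> \<in> P \<and> \<gamma> - \<alpha> \<in> P"
  by (simp add: Phi_def)

lemma stem_cases:
  assumes "\<alpha> \<in> P"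
  obtains "\<alpha> \<in> \<Gamma>" | \<gamma> where "\<gamma> \<in> \<Gamma>" "\<alpha> \<in> Phi P \<gamma>"
proof -
  have "\<alpha> \<in> \<Gamma> \<union> (\<Union>\<gamma>\<in>\<Gamma>. Phi P \<gamma>)" using assms by (simp only: stem_union[symmetric])
  then show thesis using that by blast
qed

lemma stem_not_Phi: "\<gamma> \<in> \<Gamma> \<Longrightarrow> \<delta> \<in> \<Gamma> \<Longrightarrow> \<gamma> \<notin> Phi P \<delta>"
  using stem unfolding is_stem_def by blast

lemma Phi_unique: "\<gamma> \<in> \<Gamma> \<Longrightarrow> \<delta> \<in> \<Gamma> \<Longrightarrow> \<alpha> \<in> Phi P \<gamma> \<Longrightarrow> \<alpha> \<in> Phi P \<delta> \<Longrightarrow> \<gamma> = \<delta>"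
  using stem unfolding is_stem_def by blast

text \<open>A root \<gamma> + \<beta> is not in the stem, as \<gamma> would lie in its
  \<open>Phi\<close> set. So it belongs to some \<open>Phi P \<epsilon>\<close>, and with \<mu> =
  \<epsilon> - \<gamma> - \<beta> the Jacobi identity makes \<epsilon> - \<gamma> or \<epsilon> -
  \<beta> positive. The former puts the stem root \<gamma> into \<open>Phi P \<epsilon>\<close>; the
  latter puts \<beta> there, forcing \<gamma> = \<epsilon> and \<beta> + \<mu> = 0.\<close>

lemma stem_add_not_root:
  assumes g: "\<gamma> \<in> \<Gamma>" and b: "\<beta> \<in> Phi P \<gamma>"
  shows "\<gamma> + \<beta> \<notin> \<Delta>"
proof
  assume root: "\<gamma> + \<beta> \<in> \<Delta>"
  have gP: "\<gamma> \<in> P" and bP: "\<beta> \<in> P" using stem_P[OF g] b by (auto simp: Phi_iff)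
  have dP: "\<gamma> + \<beta> \<in> P" by (rule P_add[OF gP bP root])
  show False
  proof (cases rule: stem_cases[OF dP])
    case 1
    then show False using stem_not_Phi[OF g 1] gP bP by (simp add: Phi_iff)
  next
    case (2 \<epsilon>)
    define \<mu> where "\<mu> = \<epsilon> - (\<gamma> + \<beta>)"
    have m: "\<mu> \<in> P" using 2 by (simp add: Phi_iff \<mu>_def)
    have e: "\<epsilon> = \<gamma> + \<beta> + \<mu>" by (simp add: \<mu>_def)
    have eP: "\<epsilon> \<in> P" by (rule stem_P[OF 2(1)])
    note roots = P_root[OF gP] P_root[OF bP] P_root[OF m]
    have "lie (lie (E \<gamma>) (E \<beta>)) (E \<mu>) \<noteq> 0"
      using E_lie[OF roots(1,2) root] E_lie[OF root roots(3)] N_nz[OF roots(1,2) root]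
        N_nz[OF root roots(3)] E_nz[OF P_root[OF eP]] P_root[OF eP]
      by (simp add: lie_linear e)
    then have "lie (E \<beta>) (E \<mu>) \<noteq> 0 \<or> lie (E \<gamma>) (E \<mu>) \<noteq> 0"
      using lie_jacobi[of "E \<gamma>" "E \<beta>" "E \<mu>"] by (auto simp: lie_linear)
    then have "\<beta> + \<mu> \<in> \<Delta> \<or> \<gamma> + \<mu> \<in> \<Delta>"
      using lie_E_zero roots P_add_nz gP bP m by meson
    then show False
    proof
      assume "\<beta> + \<mu> \<in> \<Delta>"
      then have "\<epsilon> - \<gamma> \<in> P" using P_add[OF bP m] by (simp add: e algebra_simps)
      then show False using stem_not_Phi[OF g 2(1)] gP by (simp add: Phi_iff)
    next
      assume "\<gamma> + \<mu> \<in> \<Delta>"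
      then have "\<epsilon> - \<beta> \<in> P" using P_add[OF gP m] by (simp add: e algebra_simps)
      then have "\<gamma> = \<epsilon>" using Phi_unique[OF g 2(1) b] bP by (simp add: Phi_iff)
      then have "\<beta> + \<mu> = 0" by (simp add: e add.assoc)
      then show False using P_add_nz[OF bP m] by simp
    qed
  qed
qed

lemma Phi_minus:
  assumes "\<gamma> \<in> \<Gamma>" "\<beta> \<in> Phi P \<gamma>"
  shows "\<beta> \<in> P" "\<gamma> - \<beta> \<in> P" "\<gamma> - \<beta> \<in> Phi P \<gamma>" "- \<gamma> + \<beta> \<in> \<Delta>"
  using assms P_minus_root[of "\<gamma> - \<beta>"] by (auto simp: Phi_iff)

text \<open>\<beta> - \<gamma> is a root and \<beta> + \<gamma> is not, so the inequality of
  \<open>coroot_nonneg\<close> is strict.\<close>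

lemma stem_coroot_pos:
  assumes g: "\<gamma> \<in> \<Gamma>" and b: "\<beta> \<in> Phi P \<gamma>"
  shows "Re (\<beta> (H\<^sub>c \<gamma>)) > 0"
proof (rule coroot_nonneg(2))
  note Phi = Phi_minus[OF g b]
  have r: "- \<gamma> \<in> \<Delta>" "\<beta> \<in> \<Delta>" using P_minus_root[OF stem_P[OF g]] P_root[OF Phi(1)] .
  show "\<gamma> \<in> \<Delta>" by (rule P_root[OF stem_P[OF g]])
  show "\<beta> \<in> \<Delta>" by (rule r(2))
  show "\<gamma> + \<beta> \<notin> \<Delta>" by (rule stem_add_not_root[OF g b])
  show "\<gamma> + \<beta> \<noteq> 0" by (rule P_add_nz[OF stem_P[OF g] Phi(1)])
  show "lie (E (- \<gamma>)) (E \<beta>) \<noteq> 0"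
    using E_lie[OF r Phi(4)] N_nz[OF r Phi(4)] E_nz[OF Phi(4)] by simp
qed

lemma pp_conj: "cx_conj (pp X) = pm (cx_conj X)"
  by (simp add: pp_def pm_def cx_conj_scale cx_conj_diff cx_extend_conj[OF I_linear])

lemma pm_coroot: "\<gamma> \<in> \<Delta> \<Longrightarrow> pm (H\<^sub>c \<gamma>) = - cx_conj (pp (H\<^sub>c \<gamma>))"
  by (simp add: pp_conj coroot_conj pm_linear)

text \<open>tau negates coroots, so it exchanges the two parts of H_gamma up to sign, and \<alpha>
  takes conjugate values on them.\<close>

lemma Re_pp_coroot:
  assumes "\<alpha> \<in> \<Delta>" "\<gamma> \<in> \<Delta>"
  shows "\<alpha> (H\<^sub>c \<gamma>) = complex_of_real (2 * Re (\<alpha> (pp (H\<^sub>c \<gamma>))))"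
proof -
  note ad = root_dual[OF assms(1)] and Hh = coroot_bracket(1)[OF assms(2)]
  have "\<alpha> (H\<^sub>c \<gamma>) = \<alpha> (pp (H\<^sub>c \<gamma>)) + \<alpha> (pm (H\<^sub>c \<gamma>))"
    using pp_pm[of "H\<^sub>c \<gamma>"] dual_add[OF ad pp_h[OF Hh] pm_h[OF Hh]] by simp
  also have "\<alpha> (pm (H\<^sub>c \<gamma>)) = cnj (\<alpha> (pp (H\<^sub>c \<gamma>)))"
    using root_conj[OF assms(1) pp_h[OF Hh]]
    by (simp add: pm_coroot[OF assms(2)] dual_minus[OF ad conj_in_h[OF pp_h[OF Hh]]])
  finally show ?thesis by (simp add: complex_eq_iff)
qed

text \<open>In [V, E_gamma] a positive root gamma - alpha contributes a vector of m+; a negative one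
  has alpha above gamma, so v_alpha = 0. Modulo m+ only -v_gamma H_gamma survives.\<close>

lemma J_E_top:
  assumes g: "\<gamma> \<in> \<Gamma>" and above: "\<And>\<alpha>. \<alpha> \<in> P \<Longrightarrow> \<alpha> - \<gamma> \<in> P \<Longrightarrow> v \<alpha> = 0"
  shows "J' (E \<gamma>) = v \<gamma> *\<^sub>C cx_conj (pp (H\<^sub>c \<gamma>))"
proof -
  have gP: "\<gamma> \<in> P" and gr: "\<gamma> \<in> \<Delta>" using stem_P[OF g] P_root by auto
  have 0: "pm (v \<alpha> *\<^sub>C lie (E (- \<alpha>)) (E \<gamma>)) = 0" if a: "\<alpha> \<in> P" and ne: "\<alpha> \<noteq> \<gamma>" for \<alpha>
  proof (cases "- \<alpha> + \<gamma> \<in> \<Delta>")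
    case True
    then show ?thesis
    proof (cases rule: root_cases)
      case 1
      then show ?thesis
        using E_lie[OF P_minus_root[OF a] gr True] pm_of_mp[OF E_mp[OF 1]] by (simp add: pm_linear)
    next
      case (2 \<beta>)
      then have "\<alpha> - \<gamma> \<in> P" by (metis minus_diff_eq minus_minus uminus_add_conv_diff)
      then show ?thesis using above[OF a] by (simp add: pm_linear)
    qed
  next
    case False
    then show ?thesis
      using lie_E_zero[OF P_minus_root[OF a] gr False] ne by (simp add: pm_linear)
  qed
  have "J' (E \<gamma>) = (\<Sum>\<alpha>\<in>P. pm (v \<alpha> *\<^sub>C lie (E (- \<alpha>)) (E \<gamma>)))"
    by (simp add: J_E[OF gP] V_def lie_sum lie_linear pm_sum)
  also have "\<dots> = (\<Sum>\<alpha>\<in>{\<gamma>}. pm (v \<alpha> *\<^sub>C lie (E (- \<alpha>)) (E \<gamma>)))"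
    using gP 0 finite_P by (intro sum.mono_neutral_right) auto
  also have "\<dots> = v \<gamma> *\<^sub>C cx_conj (pp (H\<^sub>c \<gamma>))"
    using E_bracket[OF gr] lie_antisym[of "E (- \<gamma>)" "E \<gamma>"] by (simp add: pm_linear pm_coroot[OF gr])
  finally show ?thesis .
qed

text \<open>J^2 = -1 on E_gamma, conjugated, says E_-gamma = cnj(v_gamma) J((H_gamma)_+), and
  \<open>v\<close> gives the coordinate of the right side along E_-alpha.\<close>

lemma v_coroot:
  assumes g: "\<gamma> \<in> \<Gamma>" and above: "\<And>\<alpha>. \<alpha> \<in> P \<Longrightarrow> \<alpha> - \<gamma> \<in> P \<Longrightarrow> v \<alpha> = 0"
    and a: "\<alpha> \<in> P"
  shows "cnj (v \<gamma>) * (v \<alpha> * \<alpha> (pp (H\<^sub>c \<gamma>))) = (if \<alpha> = \<gamma> then 1 else 0)"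
proof -
  have gr: "\<gamma> \<in> \<Delta>" using stem_P[OF g] P_root by auto
  define K where "K = pp (H\<^sub>c \<gamma>)"
  have K: "K \<in> h" "K \<in> mp" using pp_h[OF coroot_bracket(1)[OF gr]] pp_mp by (simp_all add: K_def)
  have "- E \<gamma> = v \<gamma> *\<^sub>C cx_conj (J' K)"
    using JJ[of "E \<gamma>"] by (simp add: J_E_top[OF g above] J_simps K_def cx_extend_conj[OF J_linear])
  then have "cx_conj (- E \<gamma>) = cnj (v \<gamma>) *\<^sub>C J' K" by (simp add: cx_conj_scale)
  then have "co (- \<alpha>) (E (- \<gamma>)) = cnj (v \<gamma>) * co (- \<alpha>) (J' K)"
    by (simp add: cx_conj_minus E_conj[OF gr] co_linear)
  then show ?thesis
    using v[OF a K] co_E[OF P_minus_root[OF a] root_uminus[OF gr]] by (auto simp: K_def)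
qed

text \<open>Both claims need one joint induction. A root above a stem root is outside the stem, so
  its coefficient is already 0; a root of Phi_gamma lies below gamma, whose relation then kills its
  coefficient.\<close>

lemma v_dichotomy:
  assumes "\<beta> \<in> P"
  shows "(\<beta> \<in> \<Gamma> \<longrightarrow> (\<forall>\<alpha>\<in>P. cnj (v \<beta>) * (v \<alpha> * \<alpha> (pp (H\<^sub>c \<beta>))) = (if \<alpha> = \<beta> then 1 else 0))) \<and>
    (\<beta> \<notin> \<Gamma> \<longrightarrow> v \<beta> = 0)"
  using wf_above assms
proof (induction \<beta> rule: wf_induct_rule)
  case (less \<beta>)
  show ?case
  proof (cases rule: stem_cases[OF less.prems])
    case 1
    have "v \<alpha> = 0" if "\<alpha> \<in> P" "\<alpha> - \<beta> \<in> P" for \<alpha>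
      using less.IH[of \<alpha>] that less.prems stem_not_Phi[OF 1, of \<alpha>] by (auto simp: Phi_iff)
    then show ?thesis using v_coroot[OF 1] 1 by blast
  next
    case (2 \<gamma>)
    have g: "\<gamma> \<in> P" by (rule stem_P[OF 2(1)])
    have ne: "\<beta> \<noteq> \<gamma>" using 2 stem_not_Phi by blast
    have IH: "cnj (v \<gamma>) * (v \<alpha> * \<alpha> (pp (H\<^sub>c \<gamma>))) = (if \<alpha> = \<gamma> then 1 else 0)" if "\<alpha> \<in> P" for \<alpha>
      using less.IH[of \<gamma>] 2 g less.prems that by (auto simp: Phi_iff)
    have "Re (\<beta> (pp (H\<^sub>c \<gamma>))) > 0"
      using stem_coroot_pos[OF 2] Re_pp_coroot[OF P_root[OF less.prems] P_root[OF g]] by simp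
    then have "\<beta> (pp (H\<^sub>c \<gamma>)) \<noteq> 0" by auto
    moreover have "v \<gamma> \<noteq> 0" using IH[OF g] by auto
    ultimately have "v \<beta> = 0" using IH[OF less.prems] ne by simp
    then show ?thesis using 2 stem_not_Phi by blast
  qed
qed

lemma v_outside: "\<beta> \<in> P \<Longrightarrow> \<beta> \<notin> \<Gamma> \<Longrightarrow> v \<beta> = 0"
  using v_dichotomy by blast

lemma v_stem: "\<gamma> \<in> \<Gamma> \<Longrightarrow> \<alpha> \<in> P \<Longrightarrow> cnj (v \<gamma>) * (v \<alpha> * \<alpha> (pp (H\<^sub>c \<gamma>))) = (if \<alpha> = \<gamma> then 1 else 0)"
  using v_dichotomy[OF stem_P] by blast

lemma v_stem_nz: "\<gamma> \<in> \<Gamma> \<Longrightarrow> v \<gamma> \<noteq> 0"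
  using v_stem[OF _ stem_P, of \<gamma> \<gamma>] by auto

lemma v_above: "\<gamma> \<in> \<Gamma> \<Longrightarrow> \<alpha> \<in> P \<Longrightarrow> \<alpha> - \<gamma> \<in> P \<Longrightarrow> v \<alpha> = 0"
  using v_outside[of \<alpha>] stem_not_Phi[of \<gamma> \<alpha>] stem_P[of \<gamma>] by (auto simp: Phi_iff)

lemma J_E_stem: "\<gamma> \<in> \<Gamma> \<Longrightarrow> J' (E \<gamma>) = v \<gamma> *\<^sub>C cx_conj (pp (H\<^sub>c \<gamma>))"
  by (rule J_E_top) (auto intro: v_above)

text \<open>Both coefficients are nonzero, so the relation forces \<delta>((H_gamma)_+) = 0, and
  \<delta>(H_gamma) is twice its real part.\<close>

lemma stem_orthogonal:
  assumes "\<gamma> \<in> \<Gamma>" "\<delta> \<in> \<Gamma>" "\<gamma> \<noteq> \<delta>"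
  shows "\<delta> (H\<^sub>c \<gamma>) = 0"
  using v_stem[OF assms(1) stem_P[OF assms(2)]] v_stem_nz assms
    Re_pp_coroot[OF P_root[OF stem_P[OF assms(2)]] P_root[OF stem_P[OF assms(1)]]] by auto

text \<open>The relation at \<gamma> itself is |v_gamma|^2 \<gamma>((H_gamma)_+) = 1, and the second
  factor has real part \<gamma>(H_gamma)/2 = 1.\<close>

lemma norm_v:
  assumes g: "\<gamma> \<in> \<Gamma>"
  shows "cnj (v \<gamma>) * v \<gamma> = 1"
proof -
  have gr: "\<gamma> \<in> \<Delta>" by (rule P_root[OF stem_P[OF g]])
  let ?z = "\<gamma> (pp (H\<^sub>c \<gamma>))"
  have e: "complex_of_real ((cmod (v \<gamma>))\<^sup>2) * ?z = 1"
    using v_stem[OF g stem_P[OF g]] unfolding complex_norm_square by (simp add: mult_ac)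
  have "complex_of_real (2 * Re ?z) = 2" using Re_pp_coroot[OF gr gr] coroot_bracket(2)[OF gr] by simp
  then have "Re ?z = 1" by (simp add: complex_eq_iff)
  then have "(cmod (v \<gamma>))\<^sup>2 = 1" using arg_cong[OF e, of Re] by simp
  then show ?thesis by (metis complex_norm_square mult.commute of_real_1)
qed

text \<open>Only stem terms of V remain. If \<beta> - \<alpha> is a negative root for a stem root
  \<alpha>, then \<beta> lies in Phi_alpha and disjointness gives \<alpha> = \<gamma>; positive
  roots vanish modulo m+.\<close>

lemma J_E_Phi:
  assumes g: "\<gamma> \<in> \<Gamma>" and b: "\<beta> \<in> Phi P \<gamma>"
  shows "J' (E \<beta>) = (v \<gamma> * of_int (N (- \<gamma>) \<beta>)) *\<^sub>C E (- \<gamma> + \<beta>)"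
proof -
  note Phi = Phi_minus[OF g b]
  have gP: "\<gamma> \<in> P" and br: "\<beta> \<in> \<Delta>" using stem_P[OF g] P_root[OF Phi(1)] by auto
  have 0: "pm (v \<alpha> *\<^sub>C lie (E (- \<alpha>)) (E \<beta>)) = 0" if a: "\<alpha> \<in> P" and ne: "\<alpha> \<noteq> \<gamma>" for \<alpha>
  proof (cases "\<alpha> \<in> \<Gamma>")
    case al: True
    show ?thesis
    proof (cases "- \<alpha> + \<beta> \<in> \<Delta>")
      case True
      then show ?thesis
      proof (cases rule: root_cases)
        case 1
        then show ?thesis
          using E_lie[OF P_minus_root[OF a] br True] pm_of_mp[OF E_mp[OF 1]] by (simp add: pm_linear)
      next
        case (2 \<epsilon>)
        then have "\<alpha> - \<beta> \<in> P" by (metis minus_diff_eq minus_minus uminus_add_conv_diff)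
        then have "\<alpha> = \<gamma>" using Phi_unique[OF al g _ b] Phi(1) by (simp add: Phi_iff)
        then show ?thesis using ne by simp
      qed
    next
      case False
      have "\<alpha> \<noteq> \<beta>" using al b g stem_not_Phi by blast
      then show ?thesis
        using lie_E_zero[OF P_minus_root[OF a] br False] by (simp add: pm_linear)
    qed
  qed (simp add: v_outside[OF a] pm_linear)
  have mm: "E (- \<gamma> + \<beta>) \<in> mm" using E_mm[OF Phi(2)] by simp
  have "J' (E \<beta>) = (\<Sum>\<alpha>\<in>P. pm (v \<alpha> *\<^sub>C lie (E (- \<alpha>)) (E \<beta>)))"
    by (simp add: J_E[OF Phi(1)] V_def lie_sum lie_linear pm_sum)
  also have "\<dots> = (\<Sum>\<alpha>\<in>{\<gamma>}. pm (v \<alpha> *\<^sub>C lie (E (- \<alpha>)) (E \<beta>)))"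
    using gP 0 finite_P by (intro sum.mono_neutral_right) auto
  also have "\<dots> = pm ((v \<gamma> * of_int (N (- \<gamma>) \<beta>)) *\<^sub>C E (- \<gamma> + \<beta>))"
    using E_lie[OF P_minus_root[OF gP] br Phi(4)] by simp
  also have "\<dots> = (v \<gamma> * of_int (N (- \<gamma>) \<beta>)) *\<^sub>C E (- \<gamma> + \<beta>)"
    by (rule pm_of_mm[OF mm_closed(3)[OF mm]])
  finally show ?thesis .
qed

text \<open>\<open>J\<^sup>2 = -1\<close> on \<open>E\<^sub>\<beta>\<close> says \<open>N\<^sub>-\<^sub>\<gamma>\<^sub>,\<^sub>\<beta> N\<^sub>-\<^sub>\<gamma>\<^sub>,\<^sub>\<gamma>\<^sub>-\<^sub>\<beta> = -1\<close>, and this product is \<open>- \<beta>(H\<^sub>\<gamma>)\<close>.\<close>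

lemma Phi_coroot:
  assumes g: "\<gamma> \<in> \<Gamma>" and b: "\<beta> \<in> Phi P \<gamma>"
  shows "\<beta> (H\<^sub>c \<gamma>) = 1"
proof -
  note Phi = Phi_minus[OF g b]
  have gP: "\<gamma> \<in> P" and gr: "\<gamma> \<in> \<Delta>" and br: "\<beta> \<in> \<Delta>" and dr: "\<gamma> - \<beta> \<in> \<Delta>"
    using stem_P[OF g] P_root Phi by auto
  define n m where "n = complex_of_int (N (- \<gamma>) \<beta>)" and "m = complex_of_int (N (- \<gamma>) (\<gamma> - \<beta>))"
  have Jb: "J' (E \<beta>) = (v \<gamma> * n) *\<^sub>C E (- \<gamma> + \<beta>)"
    by (simp add: n_def J_E_Phi[OF g b])
  have Jd: "J' (E (\<gamma> - \<beta>)) = (v \<gamma> * m) *\<^sub>C E (- \<beta>)"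
    using J_E_Phi[OF g Phi(3)] by (simp add: m_def)
  \<comment> \<open>Conjugation reduces this negative root vector to the positive root
    \<open>\<gamma> - \<beta>\<close>, which also lies in \<open>Phi P \<gamma>\<close>.\<close>
  have "E (- \<gamma> + \<beta>) = - cx_conj (E (\<gamma> - \<beta>))" using E_conj[OF dr] by simp
  then have "J' (E (- \<gamma> + \<beta>)) = - cx_conj (J' (E (\<gamma> - \<beta>)))"
    by (simp add: J_simps cx_extend_conj[OF J_linear])
  also have "\<dots> = (cnj (v \<gamma>) * m) *\<^sub>C E \<beta>"
    using E_conj[OF root_uminus[OF br]] by (simp add: Jd cx_conj_scale m_def)
  finally have "J' (J' (E \<beta>)) = (cnj (v \<gamma>) * v \<gamma> * (n * m)) *\<^sub>C E \<beta>"
    by (simp add: Jb J_simps mult_ac)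
  then have "co \<beta> (- E \<beta>) = co \<beta> ((n * m) *\<^sub>C E \<beta>)" by (simp add: JJ norm_v[OF g])
  then have nm: "n * m = - 1" using br by (simp add: co_linear co_E)
  have N2: "complex_of_int (N \<gamma> (\<beta> - \<gamma>)) = - m"
    using N_minus[OF gr Phi(4)] br by (simp add: m_def)
  have "\<beta> (H\<^sub>c \<gamma>) *\<^sub>C E \<beta> = lie (E \<gamma>) (lie (E (- \<gamma>)) (E \<beta>))"
    by (rule lie_E_E[symmetric]) (use gr br stem_add_not_root[OF g b] P_add_nz[OF gP Phi(1)] in auto)
  also have "\<dots> = (- (n * m)) *\<^sub>C E \<beta>"
    using E_lie[OF root_uminus[OF gr] br Phi(4)] E_lie[OF gr Phi(4)] br
    by (simp add: lie_linear N2 flip: n_def)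
  finally have "\<beta> (H\<^sub>c \<gamma>) *\<^sub>C E \<beta> = 1 *\<^sub>C E \<beta>" by (simp add: nm)
  then show ?thesis using E_nz[OF br] by (simp only: cx.scale_cancel_right simp_thms)
qed

text \<open>v_beta \<beta>(X) is 0 for every positive \<beta>: off the stem the first factor
  vanishes, on it the second. So J X stays in \<open>h\<close>. As J sends tau(J X) back into
  \<open>h\<close>, the same formula with v_gamma nonzero shows that the stem annihilates tau(J
  X).\<close>

lemma J_j_plus:
  assumes X: "X \<in> j_plus h \<Gamma> I"
  shows "J' X \<in> h" "cx_conj (J' X) \<in> j_plus h \<Gamma> I"
proof -
  have Xh: "X \<in> h" "X \<in> mp" and X0: "\<And>\<gamma>. \<gamma> \<in> \<Gamma> \<Longrightarrow> \<gamma> X = 0"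
    using X by (auto simp: j_plus_def h_plus_def stem_annihilator_def mp_def)
  show Jh: "J' X \<in> h"
  proof (rule mem_h)
    fix \<alpha> assume "\<alpha> \<in> \<Delta>"
    then show "co \<alpha> (J' X) = 0"
    proof (cases rule: root_cases)
      case 1
      then show ?thesis by (rule co_mm[OF J_mp[OF Xh(2)]])
    next
      case (2 \<beta>)
      then show ?thesis using v[OF _ Xh, of \<beta>] X0 v_outside by (cases "\<beta> \<in> \<Gamma>") auto
    qed
  qed
  let ?Y = "cx_conj (J' X)"
  have Y: "?Y \<in> h" "?Y \<in> mp" using conj_in_h[OF Jh] conj_mm[OF J_mp[OF Xh(2)]] .
  have JY: "J' ?Y = - cx_conj X" by (simp add: cx_extend_conj[OF J_linear] JJ cx_conj_minus)
  have "\<gamma> ?Y = 0" if g: "\<gamma> \<in> \<Gamma>" for \<gamma>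
  proof -
    have "v \<gamma> * \<gamma> ?Y = co (- \<gamma>) (J' ?Y)" using v[OF stem_P[OF g] Y] by simp
    also have "\<dots> = 0"
      by (rule co_h[OF P_minus_root[OF stem_P[OF g]]]) (simp add: JY h_closed conj_in_h[OF Xh(1)])
    finally show ?thesis using v_stem_nz[OF g] by simp
  qed
  then show "?Y \<in> j_plus h \<Gamma> I"
    using Y by (auto simp: j_plus_def h_plus_def stem_annihilator_def mp_def)
qed

text \<open>W + iIW is twice the m- part of W, that is i times the m- part of the coroot.\<close>

lemma Q_vec_eq:
  assumes "\<gamma> \<in> \<Delta>"
  shows "Q_vec br h I \<gamma> = (- \<i>) *\<^sub>C cx_conj (pp (H\<^sub>c \<gamma>))"
proof -
  have "Q_vec br h I \<gamma> = \<i> *\<^sub>C pm (H\<^sub>c \<gamma>)"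
    by (simp add: Q_vec_def Z_vec_def W_vec_def pm_def I_simps cx.scale_right_distrib)
  then show ?thesis by (simp add: pm_coroot[OF assms] cx.scale_minus_left)
qed

text \<open>Orthogonality of the stem lets the values \<gamma>(T) be prescribed independently.
  Conjugation by the torus element turns v_gamma into exp(-\<gamma>(T)) v_gamma, which is -i for the
  stated value.\<close>

lemma aligned_torus:
  obtains T where "T \<in> h" "cx_conj T = T" "\<And>\<gamma>. \<gamma> \<in> \<Gamma> \<Longrightarrow> exp (\<gamma> T) = \<i> * v \<gamma>"
proof -
  have fin: "finite \<Gamma>" using finite_P stem_P by (meson finite_subset subsetI)
  have root: "\<gamma> \<in> \<Delta>" if "\<gamma> \<in> \<Gamma>" for \<gamma> by (rule P_root[OF stem_P[OF that]])
  \<comment> \<open>The half cancels \<gamma>(H_gamma) = 2; the factor \<open>\<i>\<close> makes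
    \<open>T\<close> real, as tau negates coroots.\<close>
  define c where "c \<gamma> = \<i> * complex_of_real (Arg (\<i> * v \<gamma>)) / 2" for \<gamma>
  define T where "T = (\<Sum>\<gamma>\<in>\<Gamma>. c \<gamma> *\<^sub>C H\<^sub>c \<gamma>)"
  have mem: "c \<gamma> *\<^sub>C H\<^sub>c \<gamma> \<in> h" if "\<gamma> \<in> \<Gamma>" for \<gamma>
    by (rule h_closed(3)[OF coroot_bracket(1)[OF root[OF that]]])
  show ?thesis
  proof
    show "T \<in> h" unfolding T_def by (rule h_closed(6)) (rule mem)
    have "cx_conj (c \<gamma> *\<^sub>C H\<^sub>c \<gamma>) = c \<gamma> *\<^sub>C H\<^sub>c \<gamma>" if "\<gamma> \<in> \<Gamma>" for \<gamma>
      by (simp add: cx_conj_scale coroot_conj[OF root[OF that]] c_def cx.scale_minus_left)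
    then show "cx_conj T = T" unfolding T_def cx_conj_sum by (rule sum.cong[OF refl])
    show "exp (\<gamma> T) = \<i> * v \<gamma>" if g: "\<gamma> \<in> \<Gamma>" for \<gamma>
    proof -
      have "\<gamma> T = (\<Sum>\<delta>\<in>\<Gamma>. \<gamma> (c \<delta> *\<^sub>C H\<^sub>c \<delta>))"
        unfolding T_def by (rule dual_sum[OF root_dual[OF root[OF g]] mem])
      also have "\<dots> = (\<Sum>\<delta>\<in>\<Gamma>. if \<delta> = \<gamma> then \<i> * complex_of_real (Arg (\<i> * v \<gamma>)) else 0)"
        using stem_orthogonal[OF _ g] coroot_bracket(1,2) root g
        by (intro sum.cong) (auto simp: dual_scale[OF root_dual[OF root[OF g]]] c_def)
      finally have "exp (\<gamma> T) = cis (Arg (\<i> * v \<gamma>))" using g fin by (simp add: cis_conv_exp)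
      also have "\<dots> = sgn (\<i> * v \<gamma>)" using v_stem_nz[OF g] by (intro cis_Arg) simp
      also have "\<dots> = \<i> * v \<gamma>"
      proof -
        have "complex_of_real ((cmod (v \<gamma>))\<^sup>2) = 1"
          using norm_v[OF g] unfolding complex_norm_square by (simp add: mult.commute)
        then have "(cmod (v \<gamma>))\<^sup>2 = 1" using of_real_eq_1_iff by blast
        then have "cmod (v \<gamma>) = 1" using norm_ge_zero[of "v \<gamma>"] by (auto simp: power2_eq_1_iff)
        then have "cmod (\<i> * v \<gamma>) = 1" by (simp add: norm_mult)
        then show ?thesis by (simp add: sgn_div_norm del: norm_mult)
      qed
      finally show ?thesis .
    qed
  qed
qed

text \<open>X to tau(J X) is an antilinear map of j+ to itself; \<open>b\<close> collects the
  conjugates of its coefficients, and J^2 = -1 on the basis becomes the matrix identity.\<close>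

lemma j_plus_matrix:
  fixes S :: "nat \<Rightarrow> 'u cx" and p :: nat
  assumes inj: "inj_on S {..<p}" and ind: "cx.independent (S ` {..<p})"
    and sp: "cx.span (S ` {..<p}) = j_plus h \<Gamma> I"
  obtains b :: "complex mat" where "b \<in> carrier_mat p p" "map_mat cnj b * b = - 1\<^sub>m p"
    "\<And>q. q < p \<Longrightarrow> J' (S q) = (\<Sum>k<p. (b $$ (k, q)) *\<^sub>C cx_conj (S k))"
proof -
  have expand: "\<exists>c. X = (\<Sum>k<p. c k *\<^sub>C S k)" if X: "X \<in> j_plus h \<Gamma> I" for X
  proof -
    obtain u where "X = (\<Sum>Y\<in>S ` {..<p}. u Y *\<^sub>C Y)"
      using X unfolding sp[symmetric] cx.span_finite[OF finite_imageI[OF finite_lessThan]] by blast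
    then have "X = (\<Sum>k<p. u (S k) *\<^sub>C S k)" by (simp add: sum.reindex[OF inj])
    then show ?thesis by (rule exI[where x = "\<lambda>k. u (S k)"])
  qed
  have unique: "c k = 0" if "(\<Sum>k<p. c k *\<^sub>C S k) = 0" "k < p" for c k
  proof -
    let ?u = "\<lambda>Y. c (the_inv_into {..<p} S Y)"
    have "(\<Sum>Y\<in>S ` {..<p}. ?u Y *\<^sub>C Y) = 0"
      using that(1) by (simp add: sum.reindex[OF inj] the_inv_into_f_f[OF inj])
    then have "?u (S k) = 0"
      using cx.independentD[OF ind _ subset_refl, of ?u "S k"] that(2) by simp
    then show ?thesis using that(2) by (simp add: the_inv_into_f_f[OF inj])
  qed
  have Sj: "S q \<in> j_plus h \<Gamma> I" if "q < p" for q
    using that by (auto simp flip: sp intro: cx.span_base)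
  obtain c where c: "\<And>q. q < p \<Longrightarrow> cx_conj (J' (S q)) = (\<Sum>k<p. c q k *\<^sub>C S k)"
    using expand[OF J_j_plus(2)[OF Sj]] by metis
  define b where "b = mat p p (\<lambda>(k, q). cnj (c q k))"
  have JS: "J' (S q) = (\<Sum>k<p. (b $$ (k, q)) *\<^sub>C cx_conj (S k))" if q: "q < p" for q
  proof -
    have "J' (S q) = cx_conj (\<Sum>k<p. c q k *\<^sub>C S k)" by (simp flip: c[OF q])
    also have "\<dots> = (\<Sum>k<p. (b $$ (k, q)) *\<^sub>C cx_conj (S k))"
      using q by (simp add: cx_conj_sum cx_conj_scale b_def)
    finally show ?thesis .
  qed
  have entries: "(\<Sum>k<p. cnj (b $$ (l, k)) * b $$ (k, q)) = (if l = q then - 1 else 0)"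
    if l: "l < p" and q: "q < p" for l q
  proof -
    \<comment> \<open>J commutes with tau, so these coefficients are the conjugates of column
      \<open>k\<close> of \<open>b\<close>.\<close>
    have JT: "J' (cx_conj (S k)) = (\<Sum>l<p. c k l *\<^sub>C S l)" if "k < p" for k
      using c[OF that] by (simp add: cx_extend_conj[OF J_linear])
    have "- S q = (\<Sum>k<p. (b $$ (k, q)) *\<^sub>C J' (cx_conj (S k)))"
      using JJ[of "S q"] by (simp add: JS[OF q] cx_extend_sum[OF J_linear] J_simps)
    also have "\<dots> = (\<Sum>k<p. \<Sum>l<p. (c k l * b $$ (k, q)) *\<^sub>C S l)"
      by (simp add: JT cx.scale_sum_right mult.commute)
    also have "\<dots> = (\<Sum>l<p. (\<Sum>k<p. c k l * b $$ (k, q)) *\<^sub>C S l)"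
      by (subst sum.swap) (simp add: cx.scale_sum_left)
    finally have 1: "(\<Sum>l<p. (\<Sum>k<p. c k l * b $$ (k, q)) *\<^sub>C S l) + S q = 0"
      by (metis add.left_inverse)
    have "S q = (\<Sum>l<p. if l = q then S q else 0)" using q by simp
    also have "\<dots> = (\<Sum>l<p. (if l = q then 1 else 0) *\<^sub>C S l)" by (rule sum.cong) auto
    finally have 2: "S q = (\<Sum>l<p. (if l = q then 1 else 0) *\<^sub>C S l)" .
    have "(\<Sum>l<p. ((\<Sum>k<p. c k l * b $$ (k, q)) + (if l = q then 1 else 0)) *\<^sub>C S l) = 0"
      unfolding cx.scale_left_distrib sum.distrib 2[symmetric] by (rule 1)
    then have "(\<Sum>k<p. c k l * b $$ (k, q)) + (if l = q then 1 else 0) = 0"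
      by (rule unique[OF _ l])
    moreover have "(\<Sum>k<p. cnj (b $$ (l, k)) * b $$ (k, q)) = (\<Sum>k<p. c k l * b $$ (k, q))"
      using l by (intro sum.cong) (auto simp: b_def)
    ultimately show ?thesis by (auto simp: add_eq_0_iff2 split: if_splits)
  qed
  have bc: "b \<in> carrier_mat p p" by (simp add: b_def)
  moreover have "map_mat cnj b * b = - 1\<^sub>m p"
  proof (rule eq_matI)
    fix l q assume "l < dim_row (- 1\<^sub>m p :: complex mat)" "q < dim_col (- 1\<^sub>m p :: complex mat)"
    then have lq: "l < p" "q < p" by auto
    then have "(map_mat cnj b * b) $$ (l, q) = (\<Sum>k<p. cnj (b $$ (l, k)) * b $$ (k, q))"
      using bc by (simp add: scalar_prod_def atLeast0LessThan)
    then show "(map_mat cnj b * b) $$ (l, q) = (- 1\<^sub>m p) $$ (l, q)"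
      using lq by (simp add: entries)
  qed (use bc in auto)
  ultimately show ?thesis using JS that by blast
qed

end

section \<open>Rotation of the given structure into the normal form\<close>

theorem theorem4p32:
  fixes br :: "'u::real_vector \<Rightarrow> 'u \<Rightarrow> 'u"
    and h :: "'u cx set"
    and P \<Gamma> :: "('u cx \<Rightarrow> complex) set"
    and E :: "('u cx \<Rightarrow> complex) \<Rightarrow> 'u cx"
    and N :: "('u cx \<Rightarrow> complex) \<Rightarrow> ('u cx \<Rightarrow> complex) \<Rightarrow> int"
    and I J\<^sub>0 :: "'u \<Rightarrow> 'u"
    and S :: "nat \<Rightarrow> 'u cx"
    and p :: nat
  assumes "compact_lie_algebra br"
    and "cartan_subalgebra br h" and "cx_conj ` h = h"
    and "positive_system (roots br h) P"
    and "weyl_chevalley_basis br h E N"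
    and "is_stem P \<Gamma>"
    and "even p" and "cx.dim h = 2 * card \<Gamma> + 2 * p"
    and "b_plus_complex_structure br h P I" and "admissible br I"
    and "inj_on S {..<p}" and "cx.independent (S ` {..<p})"
    and "cx.span (S ` {..<p}) = j_plus h \<Gamma> I"
    and "hypercomplex_structure br I J\<^sub>0"
  shows "\<exists>J. hypercomplex_structure br I J \<and>
           hypercomplex_equivalent br (I, J\<^sub>0) (I, J) \<and>
           (\<exists>b :: complex mat. b \<in> carrier_mat p p \<and> map_mat cnj b * b = - 1\<^sub>m p \<and>
              (\<forall>\<gamma>\<in>\<Gamma>. cx_extend J (E \<gamma>) = Q_vec br h I \<gamma>) \<and>
              (\<forall>\<gamma>\<in>\<Gamma>. \<forall>\<alpha>\<in>Phi P \<gamma>. cx_extend J (E \<alpha>) =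
                 (\<i> * of_int (N \<gamma> (- \<alpha>))) *\<^sub>C E (root_reflection br h \<gamma> \<alpha>)) \<and>
              (\<forall>q<p. cx_extend J (S q) = (\<Sum>k<p. (b $$ (k, q)) *\<^sub>C cx_conj (S k))))"
proof -
  interpret compact_lie_algebra br by (rule assms(1))
  obtain ip :: "'u \<Rightarrow> 'u \<Rightarrow> real" where ip: "bilinear ip" "\<forall>x y. ip x y = ip y x"
    "\<forall>x. x \<noteq> 0 \<longrightarrow> ip x x > 0" "\<forall>x y z. ip (br x y) z = ip x (br y z)"
    using invariant_inner_product by blast
  interpret stem_data br ip h E N P I J\<^sub>0 \<Gamma>
    by unfold_locales
       (use ip assms finite_dimensional in \<open>auto simp: hypercomplex_structure_def\<close>)
  obtain T where T: "T \<in> h" "cx_conj T = T" "\<And>\<gamma>. \<gamma> \<in> \<Gamma> \<Longrightarrow> exp (\<gamma> T) = \<i> * v \<gamma>"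
    using aligned_torus by blast
  have T': "- T \<in> h" "cx_conj (- T) = - T" using T h_closed by (auto simp: cx_conj_minus)
  note aut = tr_automorphism[OF T(1,2)] and aut' = tr_automorphism[OF T']
  \<comment> \<open>The torus element commutes with \<open>I\<close>, so this conjugation leaves
    \<open>I\<close> in place.\<close>
  define J where "J = tr T \<circ> J\<^sub>0 \<circ> tr (- T)"
  have J_tor: "cx_extend J X = tor T (J' (tor (- T) X))" for X
    by (simp add: J_def cx_extend_comp tr_tor[OF T(1,2)] tr_tor[OF T'])
  have commute: "tr T (I x) = I (tr T x)" "tr (- T) (I x) = I (tr (- T) x)" for x
    using aut(4) aut'(4) by (simp_all add: fun_eq_iff)
  have "integrable_complex_structure br J"
    unfolding J_def by (rule integrable_conjugate[OF J_integrable aut(3,1,2)])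
  moreover have "I (J x) = - J (I x)" for x
    by (simp add: J_def commute[symmetric] J_anti linear_neg[OF tr_tor(1)[OF T(1,2)]])
  moreover have "integrable_complex_structure br I"
    using assms(9) by (simp add: b_plus_complex_structure_def)
  ultimately have hyper: "hypercomplex_structure br I J" by (simp add: hypercomplex_structure_def)
  have "tr T \<circ> J\<^sub>0 = J \<circ> tr T"
    using aut(2) by (simp add: J_def fun_eq_iff)
  then have equiv: "hypercomplex_equivalent br (I, J\<^sub>0) (I, J)"
    using aut(3,4) by (auto simp: hypercomplex_equivalent_def)
  have exp_minus_T: "exp (\<gamma> (- T)) * v \<gamma> = - \<i>" if g: "\<gamma> \<in> \<Gamma>" for \<gamma>
    using T(3)[OF g] v_stem_nz[OF g]
    by (simp add: dual_minus[OF root_dual[OF P_root[OF stem_P[OF g]]] T(1)] exp_minus field_simps)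
  have JE: "cx_extend J (E \<gamma>) = Q_vec br h I \<gamma>" if g: "\<gamma> \<in> \<Gamma>" for \<gamma>
  proof -
    have gr: "\<gamma> \<in> \<Delta>" by (rule P_root[OF stem_P[OF g]])
    have "cx_conj (pp (H\<^sub>c \<gamma>)) \<in> h" by (rule conj_in_h[OF pp_h[OF coroot_bracket(1)[OF gr]]])
    then show ?thesis
      by (simp add: J_tor tor_E[OF gr] J_simps J_E_stem[OF g] tor_scale tor_h Q_vec_eq[OF gr]
          exp_minus_T[OF g] h_closed)
  qed
  have JPhi: "cx_extend J (E \<alpha>) = (\<i> * of_int (N \<gamma> (- \<alpha>))) *\<^sub>C E (root_reflection br h \<gamma> \<alpha>)"
    if g: "\<gamma> \<in> \<Gamma>" and a: "\<alpha> \<in> Phi P \<gamma>" for \<gamma> \<alpha>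
  proof -
    note Phi = Phi_minus[OF g a]
    have gr: "\<gamma> \<in> \<Delta>" and ar: "\<alpha> \<in> \<Delta>" using stem_P[OF g] Phi(1) P_root by auto
    note gd = root_dual[OF gr] and ad = root_dual[OF ar]
    have refl: "root_reflection br h \<gamma> \<alpha> = - \<gamma> + \<alpha>"
      by (simp add: root_reflection_def Phi_coroot[OF g a] fun_eq_iff)
    have N: "complex_of_int (N (- \<gamma>) \<alpha>) = - of_int (N \<gamma> (- \<alpha>))"
      using N_minus[OF gr root_uminus[OF ar]] P_root[OF Phi(2)] by simp
    \<comment> \<open>The phase of \<open>E \<alpha>\<close> cancels: the torus contributes
      exp(-\<alpha>(T)) before and exp((\<alpha> - \<gamma>)(T)) after \<open>J\<^sub>0\<close>,
      which leaves the factor of the stem root.\<close>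
    have "exp (\<alpha> (- T)) * (v \<gamma> * exp ((- \<gamma> + \<alpha>) T)) = exp (\<gamma> (- T)) * v \<gamma>"
      by (simp add: dual_minus[OF gd T(1)] dual_minus[OF ad T(1)] exp_add exp_diff exp_minus field_simps)
    then have e: "exp (\<alpha> (- T)) * (v \<gamma> * exp ((- \<gamma> + \<alpha>) T)) = - \<i>" by (simp add: exp_minus_T[OF g])
    have "cx_extend J (E \<alpha>) =
        (exp (\<alpha> (- T)) * (v \<gamma> * exp ((- \<gamma> + \<alpha>) T)) * of_int (N (- \<gamma>) \<alpha>)) *\<^sub>C E (- \<gamma> + \<alpha>)"
      by (simp only: J_tor tor_E[OF ar] J_simps J_E_Phi[OF g a] tor_scale tor_E[OF Phi(4)] cx.scale_scale mult_ac)
    also have "\<dots> = (\<i> * of_int (N \<gamma> (- \<alpha>))) *\<^sub>C E (root_reflection br h \<gamma> \<alpha>)"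
      unfolding e N refl by simp
    finally show ?thesis .
  qed
  obtain b :: "complex mat" where b: "b \<in> carrier_mat p p" "map_mat cnj b * b = - 1\<^sub>m p"
    "\<And>q. q < p \<Longrightarrow> J' (S q) = (\<Sum>k<p. (b $$ (k, q)) *\<^sub>C cx_conj (S k))"
    using j_plus_matrix[OF assms(11-13)] by blast
  have JS: "cx_extend J (S q) = (\<Sum>k<p. (b $$ (k, q)) *\<^sub>C cx_conj (S k))" if q: "q < p" for q
  proof -
    have j: "S q \<in> j_plus h \<Gamma> I" using q by (auto simp flip: assms(13) intro: cx.span_base)
    then have "S q \<in> h" by (auto simp: j_plus_def h_plus_def)
    \<comment> \<open>The torus fixes \<open>h\<close> pointwise, and both \<open>S q\<close> and
      its image lie in \<open>h\<close>.\<close>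
    then have "cx_extend J (S q) = J' (S q)" by (simp add: J_tor tor_h J_j_plus(1)[OF j])
    then show ?thesis using b(3)[OF q] by simp
  qed
  show ?thesis using hyper equiv b(1,2) JE JPhi JS by blast
qed

end
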